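(* Let $A$ be a finite-dimensional local commutative unital algebra over $\mathbb{R}$ with $\dim_{\mathbb{R}}A=n$, let $M$ be a compact manifold over $A$ with $\dim_A M=m$, and let $e_0=1,e_1,\dots,e_{n-1}$ be a standard basis of $A$. Let $G:M\to A$ be an $A$-differentiable function, written $G=\sum_{i=0}^{n-1}e_iG^i$ with real functions $G^i$. Then (1) the real part $g=G^0$ of $G$ is constant on $M$; (2) the $e_1$-component $G^1$ of $G$ is constant on each leaf of the canonical foliation $\mathcal{F}$ of $M$.
   Context: All objects are smooth. A manifold over $A$ of dimension $\dim_A M=m$ is a smooth real manifold $M$ of dimension $nm$ equipped with a maximal atlas of charts $U\to A^m\cong\mathbb{R}^{nm}$ whose transition maps are $A$-differentiable, i.e. their differentials at every point are $A$-linear maps $A^m\to A^m$. A function $G:M\to A$ is $A$-differentiable if its expression in every such chart has $A$-linear differential. A standard basis of $A$ is a real basis $e_0=1,e_1,\dots,e_{n-1}$ such that $e_1,\dots,e_{n-1}$ span the radical $\mathrm{Rd}(A)$ (the maximal ideal, consisting of nilpotent elements) and there are $e_1,\dots,e_r$ ($r\le n-1$) generating the radical such that every $e_k$ is a monomial $e_1^{s_1}\cdots e_r^{s_r}$. In a chart with $A$-coordinates $X^j=\sum_i e_i x^{j,i}$ ($j=1,\dots,m$), write $x^j=x^{j,0}$; the canonical foliation $\mathcal{F}$ is the foliation whose leaves are locally the sets on which $(x^1,\dots,x^m)$ is constant (the foliation tangent to $\mathrm{Rd}(A)\cdot TM$).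
   Formalization: M is additionally assumed connected (otherwise a locally constant G with different real values on two components violates (1)), and n ≥ 2 is assumed (for A = ℝ there is no e_1 and (1) fails for nonconstant smooth functions). *)

theory Defs
  imports "HOL-Analysis.Analysis"
begin

text \<open>The algebra A is modelled as a type of class
  euclidean_space (finite-dimensional real vector space, DIM = n),
  real_algebra_1 (unital real algebra, bilinear multiplication) and
  comm_ring_1 (commutative).\<close>

definition ideal_of :: "'a::comm_ring_1 set \<Rightarrow> bool" where
  "ideal_of I \<longleftrightarrow> 0 \<in> I \<and> (\<forall>x\<in>I. \<forall>y\<in>I. x + y \<in> I) \<and> (\<forall>a x. x \<in> I \<longrightarrow> a * x \<in> I)"

definition maximal_ideal :: "'a::comm_ring_1 set \<Rightarrow> bool" where
  "maximal_ideal I \<longleftrightarrow> ideal_of I \<and> I \<noteq> UNIV \<and>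
     (\<forall>J. ideal_of J \<and> I \<subseteq> J \<and> J \<noteq> UNIV \<longrightarrow> J = I)"

definition is_local :: "'a::comm_ring_1 itself \<Rightarrow> bool" where
  "is_local (T :: 'a itself) \<longleftrightarrow> (\<exists>!I::'a set. maximal_ideal I)"

definition rad :: "'a::comm_ring_1 set" where
  "rad = (THE I. maximal_ideal I)"

definition standard_basis :: "(nat \<Rightarrow> 'a::{euclidean_space,real_algebra_1,comm_ring_1}) \<Rightarrow> bool" where
  "standard_basis e \<longleftrightarrow>
     e 0 = 1 \<and> inj_on e {..<DIM('a)} \<and> independent (e ` {..<DIM('a)}) \<and>
     span (e ` {..<DIM('a)}) = UNIV \<and>
     span (e ` {1..<DIM('a)}) = rad \<and>
     (\<exists>r. r \<le> DIM('a) - 1 \<and>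
        (\<forall>k\<in>{1..<DIM('a)}. \<exists>s::nat \<Rightarrow> nat. e k = (\<Prod>j\<in>{1..r}. e j ^ s j)))"

definition bcoord :: "(nat \<Rightarrow> 'a::{euclidean_space,real_algebra_1,comm_ring_1}) \<Rightarrow> nat \<Rightarrow> 'a \<Rightarrow> real" where
  "bcoord e i y = (THE c. (\<forall>k\<ge>DIM('a). c k = 0) \<and> y = (\<Sum>k<DIM('a). c k *\<^sub>R e k)) i"

text \<open>Infinitely differentiable (C-infinity) maps on a set S (used for open S).\<close>
coinductive smooth_on :: "'a::real_normed_vector set \<Rightarrow> ('a \<Rightarrow> 'b::real_normed_vector) \<Rightarrow> bool"
  for S where
  "(\<forall>x\<in>S. (f has_derivative f' x) (at x)) \<Longrightarrow> (\<forall>v. smooth_on S (\<lambda>x. f' x v)) \<Longrightarrow> smooth_on S f"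

definition ascale :: "'a::comm_ring_1 \<Rightarrow> 'a ^ 'k \<Rightarrow> 'a ^ 'k" where
  "ascale c v = (\<chi> j. c * v $ j)"

definition A_linear_endo :: "('a::{euclidean_space,real_algebra_1,comm_ring_1} ^ 'k \<Rightarrow> 'a ^ 'k) \<Rightarrow> bool" where
  "A_linear_endo L \<longleftrightarrow> linear L \<and> (\<forall>c v. L (ascale c v) = ascale c (L v))"

definition A_linear_fun :: "('a::{euclidean_space,real_algebra_1,comm_ring_1} ^ 'k \<Rightarrow> 'a) \<Rightarrow> bool" where
  "A_linear_fun L \<longleftrightarrow> linear L \<and> (\<forall>c v. L (ascale c v) = c * L v)"

type_synonym ('m, 'a, 'k) chart = "'m set \<times> ('m \<Rightarrow> 'a ^ 'k)"

definition is_chart :: "('m::topological_space, 'a::{euclidean_space,real_algebra_1,comm_ring_1}, 'k::finite) chart \<Rightarrow> bool" where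
  "is_chart c \<longleftrightarrow> (case c of (U, \<phi>) \<Rightarrow>
      open U \<and> open (\<phi> ` U) \<and> inj_on \<phi> U \<and> continuous_on U \<phi> \<and>
      continuous_on (\<phi> ` U) (inv_into U \<phi>))"

definition A_compatible :: "('m::topological_space, 'a::{euclidean_space,real_algebra_1,comm_ring_1}, 'k::finite) chart \<Rightarrow> ('m, 'a, 'k) chart \<Rightarrow> bool" where
  "A_compatible c d \<longleftrightarrow> (case c of (U, \<phi>) \<Rightarrow> case d of (V, \<psi>) \<Rightarrow>
      smooth_on (\<phi> ` (U \<inter> V)) (\<psi> \<circ> inv_into U \<phi>) \<and>
      (\<forall>x\<in>\<phi> ` (U \<inter> V). \<exists>L. ((\<psi> \<circ> inv_into U \<phi>) has_derivative L) (at x) \<and> A_linear_endo L))"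

definition A_manifold_atlas :: "('m::topological_space, 'a::{euclidean_space,real_algebra_1,comm_ring_1}, 'k::finite) chart set \<Rightarrow> bool" where
  "A_manifold_atlas \<A> \<longleftrightarrow>
     (\<forall>c\<in>\<A>. is_chart c) \<and> \<Union>(fst ` \<A>) = UNIV \<and>
     (\<forall>c\<in>\<A>. \<forall>d\<in>\<A>. A_compatible c d) \<and>
     (\<forall>c. is_chart c \<and> (\<forall>d\<in>\<A>. A_compatible c d \<and> A_compatible d c) \<longrightarrow> c \<in> \<A>)"

definition A_differentiable :: "('m::topological_space, 'a::{euclidean_space,real_algebra_1,comm_ring_1}, 'k::finite) chart set \<Rightarrow> ('m \<Rightarrow> 'a) \<Rightarrow> bool" where
  "A_differentiable \<A> G \<longleftrightarrow> (\<forall>(U, \<phi>)\<in>\<A>.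
      smooth_on (\<phi> ` U) (G \<circ> inv_into U \<phi>) \<and>
      (\<forall>x\<in>\<phi> ` U. \<exists>L. ((G \<circ> inv_into U \<phi>) has_derivative L) (at x) \<and> A_linear_fun L))"

definition same_plaque :: "('m::topological_space, 'a::{euclidean_space,real_algebra_1,comm_ring_1}, 'k::finite) chart set \<Rightarrow> (nat \<Rightarrow> 'a) \<Rightarrow> 'm \<Rightarrow> 'm \<Rightarrow> bool" where
  "same_plaque \<A> e p q \<longleftrightarrow> (\<exists>(U, \<phi>)\<in>\<A>. p \<in> U \<and>
      connected_component {y \<in> U. \<forall>j. bcoord e 0 (\<phi> y $ j) = bcoord e 0 (\<phi> p $ j)} p q)"

definition same_leaf :: "('m::topological_space, 'a::{euclidean_space,real_algebra_1,comm_ring_1}, 'k::finite) chart set \<Rightarrow> (nat \<Rightarrow> 'a) \<Rightarrow> 'm \<Rightarrow> 'm \<Rightarrow> bool" where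
  "same_leaf \<A> e = (same_plaque \<A> e)\<^sup>*\<^sup>*"

end

theory Submission
  imports Defs
begin

text \<open>
  The crucial claim is that \<open>w * G\<close> is constant for every \<open>w\<close> in the radical. As \<open>w\<close> is nilpotent,
  it suffices to show that \<open>w * G\<close> is constant whenever \<open>w * w * G\<close> is. Fix a linear functional \<open>\<mu>\<close>
  and put \<open>f = \<mu> (w * G)\<close> and \<open>h = \<mu> G\<close>. Since \<open>dG\<close> is \<open>A\<close>-linear, \<open>df (w v) = 0\<close> and
  \<open>dh (w v) = df v\<close>. At a maximum of \<open>h\<close> on a compact level set of \<open>f\<close>, moving in the direction
  \<open>w v\<close> stays in the level set, so \<open>df v = 0\<close>: every value of \<open>f\<close> is a critical value. By Sard's
  theorem the range of \<open>f\<close> is null, and being connected it is a point.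

  Now \<open>e 1 * (G x - G y) = 0\<close> with \<open>e 1 \<noteq> 0\<close>, so \<open>G x - G y\<close> is not a unit and lies in the radical;
  this is (1). Moreover \<open>dG (w v) = w * dG v = 0\<close> for \<open>w\<close> in the radical, so all of \<open>G\<close>, and in
  particular its \<open>e 1\<close>-component, is constant on the leaves; this is (2).
\<close>

section \<open>Smooth real functions\<close>

text \<open>An inductive counterpart of \<open>smooth_on\<close> for real functions, so that closure
  properties follow by induction on the order. Testing the derivative in one fixed direction at a
  time keeps every function real-valued.\<close>

primrec Ck :: "nat \<Rightarrow> 'e::euclidean_space set \<Rightarrow> ('e \<Rightarrow> real) \<Rightarrow> bool" where
  "Ck 0 S f \<longleftrightarrow> continuous_on S f"
| "Ck (Suc k) S f \<longleftrightarrow>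
     (\<exists>f'. (\<forall>x\<in>S. (f has_derivative f' x) (at x)) \<and> (\<forall>v. Ck k S (\<lambda>x. f' x v)))"

definition Cinf :: "'e::euclidean_space set \<Rightarrow> ('e \<Rightarrow> real) \<Rightarrow> bool" where
  "Cinf S f \<longleftrightarrow> (\<forall>k. Ck k S f)"

text \<open>The direction precedes the point, so that \<open>ddir f v\<close> is again a real
  function and can be differentiated in turn.\<close>

definition ddir :: "('e::euclidean_space \<Rightarrow> real) \<Rightarrow> 'e \<Rightarrow> 'e \<Rightarrow> real" where
  "ddir f v x = frechet_derivative f (at x) v"

declare Ck.simps(2) [simp del]

lemma Ck_SucI:
  assumes "\<And>x. x \<in> S \<Longrightarrow> (f has_derivative f' x) (at x)" "\<And>v. Ck k S (\<lambda>x. f' x v)"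
  shows "Ck (Suc k) S f"
  using assms unfolding Ck.simps by blast

lemma Ck_SucE:
  assumes "Ck (Suc k) S f"
  obtains f' where "\<And>x. x \<in> S \<Longrightarrow> (f has_derivative f' x) (at x)" "\<And>v. Ck k S (\<lambda>x. f' x v)"
  using assms unfolding Ck.simps by blast

lemma Ck_cong:
  assumes "open S" "\<And>x. x \<in> S \<Longrightarrow> f x = g x" "Ck k S f"
  shows "Ck k S g"
proof (cases k)
  case 0
  then show ?thesis using assms by (simp cong: continuous_on_cong)
next
  case (Suc j)
  obtain f' where f': "\<And>x. x \<in> S \<Longrightarrow> (f has_derivative f' x) (at x)" "\<And>v. Ck j S (\<lambda>x. f' x v)"
    using assms(3)[unfolded Suc] by (rule Ck_SucE) blast
  have "(g has_derivative f' x) (at x)" if "x \<in> S" for x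
    using f'(1)[OF that] assms(1) that assms(2) by (rule has_derivative_transform_within_open)
  then show ?thesis using f'(2) unfolding Suc by (rule Ck_SucI)
qed

lemma Ck_Suc_imp_Ck: "Ck (Suc k) S f \<Longrightarrow> Ck k S f"
proof (induction k arbitrary: f)
  case 0
  then obtain f' where "\<And>x. x \<in> S \<Longrightarrow> (f has_derivative f' x) (at x)"
    by (rule Ck_SucE) blast
  then have "continuous_on S f"
    by (meson has_derivative_at_withinI has_derivative_continuous_on)
  then show ?case by simp
next
  case (Suc k)
  from Suc.prems show ?case
    by (rule Ck_SucE) (rule Ck_SucI, assumption, rule Suc.IH)
qed

lemma Ck_subset: "Ck k S f \<Longrightarrow> T \<subseteq> S \<Longrightarrow> Ck k T f"
proof (induction k arbitrary: f)
  case 0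
  then show ?case by (auto intro: continuous_on_subset)
next
  case (Suc k)
  from Suc.prems(1) obtain f' where f': "\<And>x. x \<in> S \<Longrightarrow> (f has_derivative f' x) (at x)" "\<And>v. Ck k S (\<lambda>x. f' x v)"
    by (rule Ck_SucE) blast
  show ?case
    by (rule Ck_SucI[of _ _ f']) (use f' Suc in blast)+
qed

lemma Ck_const: "Ck k S (\<lambda>x. c)"
proof (induction k arbitrary: c)
  case (Suc k)
  show ?case by (rule Ck_SucI[of _ _ "\<lambda>x v. 0"]) (use Suc in auto)
qed auto

lemma Ck_add: "Ck k S f \<Longrightarrow> Ck k S g \<Longrightarrow> Ck k S (\<lambda>x. f x + g x)"
proof (induction k arbitrary: f g)
  case 0
  then show ?case by (auto intro: continuous_intros)
next
  case (Suc k)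
  obtain f' where f': "\<And>x. x \<in> S \<Longrightarrow> (f has_derivative f' x) (at x)" "\<And>v. Ck k S (\<lambda>x. f' x v)"
    using Suc.prems(1) by (rule Ck_SucE) blast
  obtain g' where g': "\<And>x. x \<in> S \<Longrightarrow> (g has_derivative g' x) (at x)" "\<And>v. Ck k S (\<lambda>x. g' x v)"
    using Suc.prems(2) by (rule Ck_SucE) blast
  show ?case
    by (rule Ck_SucI[OF has_derivative_add[OF f'(1) g'(1)] Suc.IH[OF f'(2) g'(2)]])
qed

lemma Ck_mult: "Ck k S f \<Longrightarrow> Ck k S g \<Longrightarrow> Ck k S (\<lambda>x. f x * g x)"
proof (induction k arbitrary: f g)
  case 0
  then show ?case by (auto intro: continuous_intros)
next
  case (Suc k)
  obtain f' where f': "\<And>x. x \<in> S \<Longrightarrow> (f has_derivative f' x) (at x)" "\<And>v. Ck k S (\<lambda>x. f' x v)"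
    using Suc.prems(1) by (rule Ck_SucE) blast
  obtain g' where g': "\<And>x. x \<in> S \<Longrightarrow> (g has_derivative g' x) (at x)" "\<And>v. Ck k S (\<lambda>x. g' x v)"
    using Suc.prems(2) by (rule Ck_SucE) blast
  show ?case
    by (rule Ck_SucI[OF has_derivative_mult[OF f'(1) g'(1)]
        Ck_add[OF Suc.IH[OF Ck_Suc_imp_Ck[OF Suc.prems(1)] g'(2)]
          Suc.IH[OF f'(2) Ck_Suc_imp_Ck[OF Suc.prems(2)]]]])
qed

lemma Ck_minus: "Ck k S f \<Longrightarrow> Ck k S (\<lambda>x. - f x)"
  using Ck_mult[OF Ck_const[of k S "-1"], of f] by simp

lemma Ck_diff: "Ck k S f \<Longrightarrow> Ck k S g \<Longrightarrow> Ck k S (\<lambda>x. f x - g x)"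
  using Ck_add[OF _ Ck_minus, of k S f g] by simp

lemma Ck_sum: "(\<And>i. i \<in> I \<Longrightarrow> Ck k S (f i)) \<Longrightarrow> Ck k S (\<lambda>x. \<Sum>i\<in>I. f i x)"
  by (induction I rule: infinite_finite_induct) (simp_all add: Ck_const Ck_add)

lemma Ck_inverse: "Ck k S f \<Longrightarrow> (\<And>x. x \<in> S \<Longrightarrow> f x \<noteq> 0) \<Longrightarrow> Ck k S (\<lambda>x. inverse (f x))"
proof (induction k arbitrary: f)
  case 0
  then show ?case by (auto intro: continuous_intros)
next
  case (Suc k)
  obtain f' where f': "\<And>x. x \<in> S \<Longrightarrow> (f has_derivative f' x) (at x)" "\<And>v. Ck k S (\<lambda>x. f' x v)"
    using Suc.prems(1) by (rule Ck_SucE) blast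
  have inv: "Ck k S (\<lambda>x. inverse (f x))"
    by (rule Suc.IH[OF Ck_Suc_imp_Ck[OF Suc.prems(1)] Suc.prems(2)])
  show ?case
    by (rule Ck_SucI[OF Deriv.has_derivative_inverse[OF Suc.prems(2) f'(1)]
          Ck_minus[OF Ck_mult[OF Ck_mult[OF inv f'(2)] inv]]])
qed

lemma linear_real_eq_sum_Basis:
  fixes L :: "'e::euclidean_space \<Rightarrow> real"
  assumes "linear L"
  shows "L u = (\<Sum>b\<in>Basis. (u \<bullet> b) * L b)"
proof -
  have "L u = L (\<Sum>b\<in>Basis. (u \<bullet> b) *\<^sub>R b)" by (simp add: euclidean_representation)
  also have "\<dots> = (\<Sum>b\<in>Basis. (u \<bullet> b) * L b)"
    by (simp add: linear_sum[OF assms] linear_scale[OF assms])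
  finally show ?thesis .
qed

text \<open>By the chain rule a directional derivative of the composite is a sum of products of a
  derivative of a component of \<open>\<Psi>\<close> with a partial derivative of \<open>f\<close>
  composed with \<open>\<Psi>\<close>. The latter factor is a composite of lower order, so induction
  on \<open>k\<close> applies.\<close>

lemma Ck_compose:
  assumes "open T" "\<Psi> ` T \<subseteq> S"
  shows "Ck k S f \<Longrightarrow> (\<And>b. b \<in> Basis \<Longrightarrow> Ck k T (\<lambda>y. \<Psi> y \<bullet> b)) \<Longrightarrow> Ck k T (\<lambda>y. f (\<Psi> y))"
proof (induction k arbitrary: f)
  case 0
  then have "continuous_on T \<Psi>"
    by (subst continuous_on_componentwise) simp
  then show ?case using 0(1) assms(2) by (auto intro: continuous_on_compose2)
next
  case (Suc k)
  obtain f' where f': "\<And>x. x \<in> S \<Longrightarrow> (f has_derivative f' x) (at x)" "\<And>v. Ck k S (\<lambda>x. f' x v)"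
    using Suc.prems(1) by (rule Ck_SucE) blast
  from Suc.prems(2) have "\<forall>b\<in>Basis. \<exists>p. (\<forall>x\<in>T. ((\<lambda>y. \<Psi> y \<bullet> b) has_derivative p x) (at x)) \<and> (\<forall>v. Ck k T (\<lambda>x. p x v))"
    unfolding Ck.simps by blast
  then obtain p where p: "\<And>b x. b \<in> Basis \<Longrightarrow> x \<in> T \<Longrightarrow> ((\<lambda>y. \<Psi> y \<bullet> b) has_derivative p b x) (at x)"
     "\<And>b v. b \<in> Basis \<Longrightarrow> Ck k T (\<lambda>x. p b x v)"
    by metis
  \<comment> \<open>The derivative of \<open>\<Psi>\<close> itself, assembled from those of its
    components.\<close>
  define P where "P x v = (\<Sum>b\<in>Basis. p b x v *\<^sub>R b)" for x v
  have P: "(\<Psi> has_derivative P x) (at x)" if "x \<in> T" for x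
    unfolding has_derivative_componentwise_within[of \<Psi>]
    using p(1) that by (simp add: P_def)
  have C: "((\<lambda>y. f (\<Psi> y)) has_derivative (\<lambda>v. f' (\<Psi> x) (P x v))) (at x)" if "x \<in> T" for x
  proof -
    have "\<Psi> x \<in> S" using assms(2) that by blast
    from has_derivative_compose[OF P[OF that] f'(1)[OF this]] show ?thesis .
  qed
  have eq: "f' (\<Psi> x) (P x v) = (\<Sum>b\<in>Basis. p b x v * f' (\<Psi> x) b)" if "x \<in> T" for x v
  proof -
    have "\<Psi> x \<in> S" using assms(2) that by blast
    then have "linear (f' (\<Psi> x))" using f'(1) has_derivative_linear by blast
    from linear_real_eq_sum_Basis[OF this, of "P x v"]
    show ?thesis by (simp add: P_def)
  qed
  have "Ck k T (\<lambda>x. \<Sum>b\<in>Basis. p b x v * f' (\<Psi> x) b)" for v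
  proof (rule Ck_sum)
    fix b :: 'b assume "b \<in> Basis"
    have "Ck k T (\<lambda>x. f' (\<Psi> x) b)"
      using Suc.IH[of "\<lambda>x. f' x b"] f'(2) Ck_Suc_imp_Ck[OF Suc.prems(2)] by blast
    with p(2)[OF \<open>b \<in> Basis\<close>] show "Ck k T (\<lambda>x. p b x v * f' (\<Psi> x) b)"
      by (rule Ck_mult)
  qed
  from Ck_cong[OF assms(1) _ this] have "Ck k T (\<lambda>x. f' (\<Psi> x) (P x v))" for v
    by (simp add: eq)
  with C show ?case by (rule Ck_SucI)
qed

lemma Cinf_has_derivative:
  assumes "Cinf S f" "x \<in> S"
  shows "(f has_derivative (\<lambda>v. ddir f v x)) (at x)"
proof -
  have "Ck (Suc 0) S f" using assms by (auto simp: Cinf_def)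
  then obtain D where "(f has_derivative D) (at x)" using assms(2) by (meson Ck_SucE)
  then show ?thesis unfolding ddir_def
    by (metis differentiable_def frechet_derivative_works)
qed

lemma Cinf_ddir:
  assumes "open S" "Cinf S f"
  shows "Cinf S (ddir f v)"
  unfolding Cinf_def
proof
  fix k
  have "Ck (Suc k) S f" using assms by (auto simp: Cinf_def)
  then obtain f' where f': "\<And>x. x \<in> S \<Longrightarrow> (f has_derivative f' x) (at x)" "\<And>v. Ck k S (\<lambda>x. f' x v)"
    by (rule Ck_SucE) blast
  have "f' x v = ddir f v x" if "x \<in> S" for x
    using frechet_derivative_at[of f "f' x" x] f'(1) that by (simp add: ddir_def)
  then show "Ck k S (ddir f v)" using Ck_cong[OF assms(1) _ f'(2)] by blast
qed

lemma Cinf_continuous_on: "Cinf S f \<Longrightarrow> continuous_on S f"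
  unfolding Cinf_def by (metis Ck.simps(1))

lemma Cinf_subset: "Cinf S f \<Longrightarrow> T \<subseteq> S \<Longrightarrow> Cinf T f"
  unfolding Cinf_def by (blast intro: Ck_subset)

lemma ddir_linear: "Cinf S f \<Longrightarrow> x \<in> S \<Longrightarrow> linear (\<lambda>v. ddir f v x)"
  using Cinf_has_derivative has_derivative_linear by blast

text \<open>Unfolding the coinductive predicate \<open>k\<close> times gives order \<open>k\<close>.
  The functional \<open>T\<close> commutes with differentiation and makes the function
  real-valued.\<close>

lemma smooth_on_imp_Cinf:
  fixes f :: "'e::euclidean_space \<Rightarrow> 'b::real_normed_vector"
  assumes "smooth_on S f" "bounded_linear T"
  shows "Cinf S (\<lambda>x. T (f x))"
proof -
  have "smooth_on S f \<Longrightarrow> Ck k S (\<lambda>x. T (f x))" for k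
  proof (induction k arbitrary: f)
    case 0
    then obtain f' where "\<forall>x\<in>S. (f has_derivative f' x) (at x)"
      by (rule smooth_on.cases) blast
    then have "continuous_on S f" by (meson has_derivative_at_withinI has_derivative_continuous_on)
    then show ?case using assms(2) by (simp add: bounded_linear.continuous_on)
  next
    case (Suc k)
    from Suc.prems obtain f' where f': "\<forall>x\<in>S. (f has_derivative f' x) (at x)" "\<forall>v. smooth_on S (\<lambda>x. f' x v)"
      by (rule smooth_on.cases) blast
    show ?case
    proof (rule Ck_SucI[of _ _ "\<lambda>x v. T (f' x v)"])
      show "((\<lambda>x. T (f x)) has_derivative (\<lambda>v. T (f' x v))) (at x)" if "x \<in> S" for x
        using bounded_linear.has_derivative[OF assms(2)] f'(1) that by blast
      show "Ck k S (\<lambda>x. T (f' x v))" for v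
        using Suc.IH f'(2) by blast
    qed
  qed
  then show ?thesis using assms(1) by (simp add: Cinf_def)
qed

section \<open>Sard's theorem for real functions\<close>

text \<open>By Lindelof countably many of the given neighbourhoods cover \<open>S\<close>, and
  countable unions of negligible sets are negligible.\<close>

lemma negligible_image_if_locally:
  fixes f :: "'e::second_countable_topology \<Rightarrow> 'f::euclidean_space"
  assumes "\<And>x. x \<in> S \<Longrightarrow> \<exists>N. open N \<and> x \<in> N \<and> negligible (f ` (S \<inter> N))"
  shows "negligible (f ` S)"
proof -
  define F where "F = {N. open N \<and> negligible (f ` (S \<inter> N))}"
  obtain F' where F': "F' \<subseteq> F" "countable F'" "\<Union>F' = \<Union>F"
    using Lindelof[of F] by (auto simp: F_def)
  have "S \<subseteq> \<Union>F" using assms by (force simp: F_def)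
  then have "f ` S \<subseteq> \<Union>((\<lambda>N. f ` (S \<inter> N)) ` F')"
    unfolding F'(3)[symmetric] by blast
  moreover have "negligible (\<Union>((\<lambda>N. f ` (S \<inter> N)) ` F'))"
    using F' by (intro negligible_countable_Union) (auto simp: F_def)
  ultimately show ?thesis by (rule negligible_subset[rotated])
qed

section \<open>Taylor estimates along an orthonormal family\<close>

lemma Cinf_DERIV_line:
  assumes "Cinf U g" "x + t *\<^sub>R v \<in> U"
  shows "((\<lambda>t. g (x + t *\<^sub>R v)) has_real_derivative ddir g v (x + t *\<^sub>R v)) (at t)"
proof -
  have "((\<lambda>t. x + t *\<^sub>R v) has_derivative (\<lambda>h. h *\<^sub>R v)) (at t)"
    by (auto intro!: derivative_eq_intros)
  from has_derivative_compose[OF this Cinf_has_derivative[OF assms]]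
  have "((\<lambda>t. g (x + t *\<^sub>R v)) has_derivative (\<lambda>h. ddir g (h *\<^sub>R v) (x + t *\<^sub>R v))) (at t)" .
  also have "(\<lambda>h. ddir g (h *\<^sub>R v) (x + t *\<^sub>R v)) = (\<lambda>h. ddir g v (x + t *\<^sub>R v) * h)"
    using linear_scale[OF ddir_linear[OF assms]] by auto
  finally show ?thesis by (simp add: has_field_derivative_def)
qed

lemma ddir_expand:
  assumes B: "finite B" "pairwise orthogonal B" "\<And>b. b \<in> B \<Longrightarrow> norm b = 1"
    and "u \<in> span B" "Cinf U g" "z \<in> U"
  shows "ddir g u z = (\<Sum>b\<in>B. (u \<bullet> b) * ddir g b z)"
proof -
  note lin = ddir_linear[OF assms(5,6)]
  have "ddir g u z = ddir g (\<Sum>b\<in>B. (u \<bullet> b) *\<^sub>R b) z"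
    using orthonormal_basis_expand[OF B(2,3) assms(4) B(1)] by simp
  also have "\<dots> = (\<Sum>b\<in>B. (u \<bullet> b) * ddir g b z)"
    by (simp add: linear_sum[OF lin] linear_scale[OF lin, simplified])
  finally show ?thesis .
qed

text \<open>The mean value theorem on the segment reduces the increment to the derivative in
  direction \<open>y - x\<close> at a single point. Expanding \<open>y - x\<close> in the
  orthonormal set \<open>B\<close> leaves coefficients bounded by its norm.\<close>

lemma Cinf_increment_bound:
  assumes B: "finite B" "pairwise orthogonal B" "\<And>b. b \<in> B \<Longrightarrow> norm b = 1"
    and g: "Cinf U g" and seg: "closed_segment x y \<subseteq> U" and "y - x \<in> span B"
    and c: "\<And>z b. z \<in> closed_segment x y \<Longrightarrow> b \<in> B \<Longrightarrow> \<bar>ddir g b z\<bar> \<le> c b"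
  shows "\<bar>g y - g x\<bar> \<le> (\<Sum>b\<in>B. c b) * norm (y - x)"
proof -
  have mem: "x + t *\<^sub>R (y - x) \<in> closed_segment x y" if "0 \<le> t" "t \<le> 1" for t
    using that unfolding in_segment by (intro exI[of _ t]) (auto simp: algebra_simps)
  have "\<exists>t>0. t < 1 \<and> g (x + 1 *\<^sub>R (y - x)) - g (x + 0 *\<^sub>R (y - x)) = (1 - 0) * ddir g (y - x) (x + t *\<^sub>R (y - x))"
    using seg mem by (intro MVT2 Cinf_DERIV_line[OF g]) auto
  then obtain t where t: "0 < t" "t < 1" "g y - g x = ddir g (y - x) (x + t *\<^sub>R (y - x))"
    by auto
  define z where "z = x + t *\<^sub>R (y - x)"
  have z: "z \<in> closed_segment x y" using mem t by (simp add: z_def)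
  then have "z \<in> U" using seg by auto
  have "\<bar>g y - g x\<bar> = \<bar>\<Sum>b\<in>B. ((y - x) \<bullet> b) * ddir g b z\<bar>"
    using ddir_expand[OF B assms(6) g \<open>z \<in> U\<close>] t(3) by (simp add: z_def)
  also have "\<dots> \<le> (\<Sum>b\<in>B. \<bar>((y - x) \<bullet> b) * ddir g b z\<bar>)" by (rule sum_abs)
  also have "\<dots> \<le> (\<Sum>b\<in>B. c b * norm (y - x))"
  proof (rule sum_mono)
    fix b assume b: "b \<in> B"
    have "\<bar>(y - x) \<bullet> b\<bar> \<le> norm (y - x)" using Cauchy_Schwarz_ineq2[of "y - x" b] B(3)[OF b] by simp
    moreover have "\<bar>ddir g b z\<bar> \<le> c b" using c[OF z b] .
    ultimately show "\<bar>((y - x) \<bullet> b) * ddir g b z\<bar> \<le> c b * norm (y - x)"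
      unfolding abs_mult by (subst mult.commute) (rule mult_mono, auto)
  qed
  finally show ?thesis by (simp add: sum_distrib_right)
qed

text \<open>All iterated derivatives of orders 1 to \<open>k\<close> along vectors of
  \<open>B\<close> vanish at \<open>x\<close>; the value \<open>g x\<close> itself is left
  free.\<close>

primrec flat :: "'e::euclidean_space set \<Rightarrow> nat \<Rightarrow> ('e \<Rightarrow> real) \<Rightarrow> 'e \<Rightarrow> bool" where
  "flat B 0 g x \<longleftrightarrow> True"
| "flat B (Suc k) g x \<longleftrightarrow> (\<forall>b\<in>B. ddir g b x = 0 \<and> flat B k (ddir g b) x)"

text \<open>A Taylor estimate whose constant \<open>M\<close> is uniform over the flat points of
  \<open>K\<close>. Compactness bounds the first derivatives; in the induction, the estimate for the
  derivatives \<open>ddir g b\<close> gains one power of the distance through the mean value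
  theorem.\<close>

lemma flat_increment_bound:
  assumes B: "finite B" "pairwise orthogonal B" "\<And>b. b \<in> B \<Longrightarrow> norm b = 1"
    and U: "open U" and K: "compact K" "convex K" "K \<subseteq> U" "K \<subseteq> span B"
  shows "Cinf U g \<Longrightarrow> \<exists>M\<ge>0. \<forall>x\<in>K. flat B k g x \<longrightarrow> (\<forall>y\<in>K. \<bar>g y - g x\<bar> \<le> M * norm (y - x) ^ Suc k)"
proof (induction k arbitrary: g)
  case 0
  have "\<exists>c\<ge>0. \<forall>z\<in>K. \<bar>ddir g b z\<bar> \<le> c" for b
  proof -
    have "continuous_on K (ddir g b)"
      using Cinf_continuous_on[OF Cinf_ddir[OF U 0]] K(3) continuous_on_subset by blast
    then have "bounded (ddir g b ` K)" using K(1) by (simp add: compact_continuous_image compact_imp_bounded)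
    then obtain c where "c > 0" "\<forall>x\<in>ddir g b ` K. norm x \<le> c" unfolding bounded_pos by blast
    then show ?thesis by (intro exI[of _ c]) auto
  qed
  then obtain c where c: "\<And>b. c b \<ge> 0" "\<And>b z. z \<in> K \<Longrightarrow> \<bar>ddir g b z\<bar> \<le> c b" by metis
  have "\<bar>g y - g x\<bar> \<le> (\<Sum>b\<in>B. c b) * norm (y - x)" if "x \<in> K" "y \<in> K" for x y
  proof -
    have seg: "closed_segment x y \<subseteq> K" using K(2) that by (simp add: closed_segment_subset)
    show ?thesis
      by (rule Cinf_increment_bound[OF B 0])
        (use seg K that c(2) in \<open>auto intro: span_diff\<close>)
  qed
  then show ?case using c(1) by (intro exI[of _ "\<Sum>b\<in>B. c b"]) (auto intro: sum_nonneg)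
next
  case (Suc k)
  have "\<exists>M\<ge>0. \<forall>x\<in>K. flat B k (ddir g b) x \<longrightarrow> (\<forall>y\<in>K. \<bar>ddir g b y - ddir g b x\<bar> \<le> M * norm (y - x) ^ Suc k)" for b
    using Suc.IH[OF Cinf_ddir[OF U Suc.prems]] .
  then obtain M where M: "\<And>b. M b \<ge> 0"
    "\<And>b x y. x \<in> K \<Longrightarrow> flat B k (ddir g b) x \<Longrightarrow> y \<in> K \<Longrightarrow> \<bar>ddir g b y - ddir g b x\<bar> \<le> M b * norm (y - x) ^ Suc k"
    by metis
  have "\<bar>g y - g x\<bar> \<le> (\<Sum>b\<in>B. M b) * norm (y - x) ^ Suc (Suc k)"
    if x: "x \<in> K" and fl: "flat B (Suc k) g x" and y: "y \<in> K" for x y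
  proof -
    have seg: "closed_segment x y \<subseteq> K" using K(2) x y by (simp add: closed_segment_subset)
    have "\<bar>g y - g x\<bar> \<le> (\<Sum>b\<in>B. M b * norm (y - x) ^ Suc k) * norm (y - x)"
    proof (rule Cinf_increment_bound[OF B Suc.prems])
      fix z b assume z: "z \<in> closed_segment x y" and b: "b \<in> B"
      \<comment> \<open>Flatness gives \<open>ddir g b x = 0\<close>, so the bound on increments of
        \<open>ddir g b\<close> bounds its values.\<close>
      have "\<bar>ddir g b z\<bar> = \<bar>ddir g b z - ddir g b x\<bar>" using fl b by simp
      also have "\<dots> \<le> M b * norm (z - x) ^ Suc k"
        by (rule M(2)[OF x]) (use fl b z seg in auto)
      also have "\<dots> \<le> M b * norm (y - x) ^ Suc k"
        using M(1) segment_bound1[OF z] by (intro mult_left_mono power_mono) (auto simp: norm_minus_commute)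
      finally show "\<bar>ddir g b z\<bar> \<le> M b * norm (y - x) ^ Suc k" .
    qed (use seg K x y in \<open>auto intro: span_diff\<close>)
    then show ?thesis by (simp add: sum_distrib_right[symmetric] mult_ac)
  qed
  then show ?case using M(1) by (intro exI[of _ "\<Sum>b\<in>B. M b"]) (auto intro: sum_nonneg)
qed

text \<open>The exponent exceeds the dimension \<open>d = card B\<close>. A grid of mesh
  \<open>1/n\<close> has of the order of \<open>n ^ d\<close> cells, and each is mapped into an
  interval of length of the order of \<open>1 / n ^ Suc d\<close>, so the total length is of the
  order of \<open>1 / n\<close>.\<close>

lemma negligible_image_Hoelder:
  fixes f :: "'e::euclidean_space \<Rightarrow> real"
  assumes B: "finite B" "pairwise orthogonal B" "\<And>b. b \<in> B \<Longrightarrow> norm b = 1"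
    and S: "S \<subseteq> cball x0 1" "S \<subseteq> span B"
    and M: "M \<ge> 0" "\<And>x y. x \<in> S \<Longrightarrow> y \<in> S \<Longrightarrow> \<bar>f y - f x\<bar> \<le> M * norm (y - x) ^ Suc (card B)"
  shows "negligible (f ` S)"
  unfolding negligible_outer_le
proof (intro allI impI)
  fix e :: real assume "e > 0"
  define d where "d = card B"
  \<comment> \<open>Chosen so that at most \<open>(3 * n) ^ d\<close> intervals of length
    \<open>2 * \<delta>\<close> have total length at most \<open>C / n\<close>.\<close>
  define C where "C = 3 ^ d * 2 * M * real d ^ Suc d"
  obtain n0 :: nat where n0: "C / e < real n0" using reals_Archimedean2 by blast
  define n where "n = Suc n0"
  have "n > 0" and "C / e < real n" using n0 by (auto simp: n_def)
  then have n: "n > 0" "C / real n \<le> e" using \<open>e > 0\<close> by (auto simp: field_simps)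
  \<comment> \<open>The grid cell of \<open>y\<close>, indexed by the integer parts of its
    coordinates scaled by \<open>n\<close>. On the unit ball around \<open>x0\<close> each index
    takes at most \<open>2 * n + 1\<close> values.\<close>
  define cell where "cell y = (\<lambda>b\<in>B. \<lfloor>real n * ((y - x0) \<bullet> b)\<rfloor>)" for y
  define J where "J = PiE B (\<lambda>_. {- int n..int n})"
  have "finite J" unfolding J_def using B(1) by (intro finite_PiE) auto
  have "cell ` S \<subseteq> J"
  proof
    fix i assume "i \<in> cell ` S"
    then obtain y where y: "y \<in> S" "i = cell y" by auto
    have "\<lfloor>real n * ((y - x0) \<bullet> b)\<rfloor> \<in> {- int n..int n}" if "b \<in> B" for b
    proof -
      have "\<bar>(y - x0) \<bullet> b\<bar> \<le> norm (y - x0)" using Cauchy_Schwarz_ineq2[of "y - x0" b] B(3)[OF that] by simp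
      also have "\<dots> \<le> 1" using S(1) y(1) by (auto simp: dist_norm norm_minus_commute)
      finally have "\<bar>real n * ((y - x0) \<bullet> b)\<bar> \<le> real n" by (simp add: abs_mult mult_left_le)
      then show ?thesis by (simp add: abs_le_iff) linarith
    qed
    then show "i \<in> J" by (auto simp: J_def y(2) cell_def)
  qed
  then have I: "finite (cell ` S)" "card (cell ` S) \<le> card J"
    using \<open>finite J\<close> finite_subset card_mono by blast+
  have "card J = (2 * n + 1) ^ d"
    by (simp add: J_def card_PiE[OF B(1)] d_def nat_add_distrib nat_mult_distrib)
  also have "\<dots> \<le> (3 * n) ^ d" using n by (intro power_mono) auto
  finally have cardI: "real (card (cell ` S)) \<le> (3 * real n) ^ d"
    using I(2) by (metis (mono_tags) le_trans of_nat_le_iff of_nat_mult of_nat_numeral of_nat_power)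
  \<comment> \<open>Each occupied cell gets a representative in \<open>S\<close>, whose image is the
    centre of the covering interval.\<close>
  define rep where "rep i = inv_into S cell i" for i
  define \<delta> where "\<delta> = M * (real d / real n) ^ Suc d"
  have "\<delta> \<ge> 0" using M(1) by (simp add: \<delta>_def)
  define T where "T = (\<Union>i\<in>cell ` S. cball (f (rep i)) \<delta>)"
  have sub: "f ` S \<subseteq> T"
  proof
    fix a assume "a \<in> f ` S"
    then obtain y where y: "y \<in> S" "a = f y" by auto
    define x where "x = rep (cell y)"
    have x: "x \<in> S" "cell x = cell y"
      using y(1) by (auto simp: x_def rep_def inv_into_into f_inv_into_f)
    have co: "\<bar>(y - x) \<bullet> b\<bar> \<le> 1 / real n" if "b \<in> B" for b
    proof -
      have "\<lfloor>real n * ((y - x0) \<bullet> b)\<rfloor> = \<lfloor>real n * ((x - x0) \<bullet> b)\<rfloor>"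
        using fun_cong[OF x(2), of b] that by (simp add: cell_def)
      then have "\<bar>real n * ((y - x0) \<bullet> b) - real n * ((x - x0) \<bullet> b)\<bar> \<le> 1" by linarith
      moreover have "real n * ((y - x0) \<bullet> b) - real n * ((x - x0) \<bullet> b) = real n * ((y - x) \<bullet> b)"
        by (simp add: algebra_simps inner_diff_left)
      ultimately have "real n * \<bar>(y - x) \<bullet> b\<bar> \<le> 1" by (simp add: abs_mult)
      then show ?thesis using n by (simp add: field_simps)
    qed
    have "y - x \<in> span B" using S(2) x y by (auto intro: span_diff)
    then have "norm (y - x) = norm (\<Sum>b\<in>B. ((y - x) \<bullet> b) *\<^sub>R b)"
      using orthonormal_basis_expand[OF B(2,3) _ B(1)] by simp
    also have "\<dots> \<le> (\<Sum>b\<in>B. 1 / real n)"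
      using co B(3) by (intro sum_norm_le) auto
    finally have "norm (y - x) \<le> real d / real n" by (simp add: d_def)
    then have "M * norm (y - x) ^ Suc d \<le> \<delta>"
      unfolding \<delta>_def using M(1) by (intro mult_left_mono power_mono) auto
    then have "\<bar>f y - f x\<bar> \<le> \<delta>" using M(2)[OF x(1) y(1)] by (simp add: d_def)
    then show "a \<in> T" using y by (auto simp: T_def x_def dist_real_def abs_minus_commute)
  qed
  have T: "T \<in> lmeasurable" unfolding T_def using I(1) by (intro fmeasurable.finite_UN) auto
  have "measure lebesgue T \<le> (\<Sum>i\<in>cell ` S. measure lebesgue (cball (f (rep i)) \<delta>))"
    unfolding T_def using I(1) by (intro measure_UNION_le) auto
  also have "\<dots> = (\<Sum>i\<in>cell ` S. 2 * \<delta>)"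
    using \<open>\<delta> \<ge> 0\<close> by (simp add: cball_eq_atLeastAtMost)
  also have "\<dots> = real (card (cell ` S)) * (2 * \<delta>)" by simp
  also have "\<dots> \<le> (3 * real n) ^ d * (2 * \<delta>)"
    using cardI \<open>\<delta> \<ge> 0\<close> by (intro mult_right_mono) auto
  also have "\<dots> = C / real n"
    using n by (simp add: C_def \<delta>_def field_simps power_mult_distrib)
  also have "\<dots> \<le> e" by (rule n)
  finally show "\<exists>T. f ` S \<subseteq> T \<and> T \<in> lmeasurable \<and> measure lebesgue T \<le> e"
    using sub T by blast
qed

text \<open>A straightening of the hypersurface \<open>w = 0\<close> that preserves every subspace containing \<open>v\<close>. Its
  derivative is a rank-one perturbation of the identity, so the Sherman-Morrison formula gives the
  derivative of the inverse explicitly, and with it the smoothness of the inverse.\<close>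

lemma rank_one_local_inverse:
  fixes w :: "'e::euclidean_space \<Rightarrow> real"
  assumes U: "open U" and w: "Cinf U w" and x: "x \<in> U" and v: "norm v = 1" and nz: "ddir w v x \<noteq> 0"
  obtains U' W \<Psi> where "open U'" "x \<in> U'" "U' \<subseteq> U" "open W"
    "homeomorphism U' W (\<lambda>y. y + (w y - y \<bullet> v) *\<^sub>R v) \<Psi>"
    "\<And>b. Cinf W (\<lambda>y. \<Psi> y \<bullet> b)"
    "\<And>y. y \<in> W \<Longrightarrow> (\<Psi> has_derivative
       (\<lambda>u. u - ((ddir w u (\<Psi> y) - u \<bullet> v) * inverse (ddir w v (\<Psi> y))) *\<^sub>R v)) (at y)"
proof -
  define \<Phi> where "\<Phi> y = y + (w y - y \<bullet> v) *\<^sub>R v" for y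
  define U1 where "U1 = {y \<in> U. ddir w v y \<noteq> 0}"
  have "open (U \<inter> ddir w v -` (- {0}))"
    by (rule continuous_open_preimage[OF Cinf_continuous_on[OF Cinf_ddir[OF U w]] U]) auto
  moreover have "U1 = U \<inter> ddir w v -` (- {0})" by (auto simp: U1_def)
  ultimately have "open U1" by simp
  have "x \<in> U1" "U1 \<subseteq> U" using x nz by (auto simp: U1_def)
  define L where "L y u = u + (ddir w u y - u \<bullet> v) *\<^sub>R v" for y u
  define R where "R y u = u - ((ddir w u y - u \<bullet> v) * inverse (ddir w v y)) *\<^sub>R v" for y u
  have vv: "v \<bullet> v = 1" using v by (simp add: norm_eq_1)
  have bl: "bounded_linear (\<lambda>u. ddir w u y)" if "y \<in> U1" for y
    using Cinf_has_derivative[OF w] \<open>U1 \<subseteq> U\<close> that by (blast intro: has_derivative_bounded_linear)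
  have blL: "bounded_linear (L y)" if "y \<in> U1" for y
    unfolding L_def[abs_def] using bl[OF that]
    by (intro bounded_linear_add bounded_linear_ident bounded_linear_scaleR_left[THEN bounded_linear_compose]
        bounded_linear_sub bounded_linear_inner_left)
  have blR: "bounded_linear (R y)" if "y \<in> U1" for y
    unfolding R_def[abs_def] using bl[OF that]
    by (intro bounded_linear_sub bounded_linear_ident bounded_linear_scaleR_left[THEN bounded_linear_compose]
        bounded_linear_mult_left[THEN bounded_linear_compose] bounded_linear_inner_left)
  have RL: "R y (L y u) = u" and LR: "L y (R y u) = u" if "y \<in> U1" for y u
  proof -
    have "linear (\<lambda>u. ddir w u y)" using bl[OF that] bounded_linear.linear by blast
    note lin = linear_add[OF this] linear_diff[OF this] linear_scale[OF this]
    have nz: "ddir w v y \<noteq> 0" using that by (simp add: U1_def)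
    show "R y (L y u) = u" using nz
      by (simp add: R_def L_def lin inner_left_distrib vv algebra_simps)
    show "L y (R y u) = u" using nz
      by (simp add: R_def L_def lin inner_diff_left vv algebra_simps)
  qed
  have der: "(\<Phi> has_derivative L y) (at y)" if "y \<in> U1" for y
    unfolding \<Phi>_def[abs_def] L_def[abs_def]
    using Cinf_has_derivative[OF w] \<open>U1 \<subseteq> U\<close> that
    by (auto intro!: derivative_eq_intros)
  \<comment> \<open>The inverse function theorem expects the derivative as a continuous map into
    bounded linear operators; in finite dimension continuity can be tested on each vector
    separately.\<close>
  define f' where "f' y = Blinfun (L y)" for y
  have f': "blinfun_apply (f' y) = L y" if "y \<in> U1" for y
    using blL[OF that] by (simp add: f'_def bounded_linear_Blinfun_apply)
  have contL: "continuous_on U1 (\<lambda>y. L y i)" for i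
    unfolding L_def using continuous_on_subset[OF Cinf_continuous_on[OF Cinf_ddir[OF U w]] \<open>U1 \<subseteq> U\<close>]
    by (intro continuous_intros)
  have cont: "continuous_on U1 f'"
  proof (rule continuous_on_blinfun_componentwise)
    fix i :: 'e
    show "continuous_on U1 (\<lambda>y. blinfun_apply (f' y) i)"
      using contL[of i] by (rule continuous_on_eq) (simp add: f')
  qed
  have inv: "Blinfun (R x) o\<^sub>L f' x = id_blinfun"
    by (rule blinfun_eqI)
      (simp add: f'[OF \<open>x \<in> U1\<close>] bounded_linear_Blinfun_apply[OF blR[OF \<open>x \<in> U1\<close>]] RL[OF \<open>x \<in> U1\<close>])
  obtain U' W \<Psi> g' where IFT: "open U'" "U' \<subseteq> U1" "x \<in> U'" "open W" "\<Phi> x \<in> W" "homeomorphism U' W \<Phi> \<Psi>"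
    and g': "\<And>y. y \<in> W \<Longrightarrow> (\<Psi> has_derivative (g' y)) (at y)"
       "\<And>y. y \<in> W \<Longrightarrow> g' y = Hilbert_Choice.inv (blinfun_apply (f' (\<Psi> y)))"
    using inverse_function_theorem[OF \<open>open U1\<close> _ cont \<open>x \<in> U1\<close> inv, of \<Phi>] der f' by metis
  have \<Psi>: "\<Psi> y \<in> U1" if "y \<in> W" for y
    using IFT(2,6) that by (auto simp: homeomorphism_def)
  have der\<Psi>: "(\<Psi> has_derivative R (\<Psi> y)) (at y)" if "y \<in> W" for y
  proof -
    have "Hilbert_Choice.inv (L (\<Psi> y)) = R (\<Psi> y)"
      by (rule inv_equality) (simp_all add: RL[OF \<Psi>[OF that]] LR[OF \<Psi>[OF that]])
    then show ?thesis using g'[OF that] f'[OF \<Psi>[OF that]] by simp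
  qed
  \<comment> \<open>Bootstrapping: the derivative of \<open>\<Psi>\<close> at \<open>y\<close> is
    \<open>R (\<Psi> y)\<close>, built from derivatives of \<open>w\<close> composed with
    \<open>\<Psi>\<close>. If \<open>\<Psi>\<close> has order \<open>k\<close>, so has this
    expression, and \<open>\<Psi>\<close> has order \<open>Suc k\<close>.\<close>
  have "Ck k W (\<lambda>y. \<Psi> y \<bullet> b)" for k b
  proof (induction k arbitrary: b)
    case 0
    have "continuous_on W \<Psi>" using IFT(6) by (simp add: homeomorphism_def)
    then show ?case by (auto intro: continuous_intros)
  next
    case (Suc k)
    have comp: "Ck k W (\<lambda>y. ddir w u (\<Psi> y))" for u
    proof (rule Ck_compose[OF \<open>open W\<close>, of \<Psi> U1])
      show "\<Psi> ` W \<subseteq> U1" using \<Psi> by auto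
      show "Ck k U1 (ddir w u)"
        using Cinf_subset[OF Cinf_ddir[OF U w] \<open>U1 \<subseteq> U\<close>] by (simp add: Cinf_def)
    qed (rule Suc)
    show ?case
    proof (rule Ck_SucI[of _ _ "\<lambda>y u. R (\<Psi> y) u \<bullet> b"])
      show "((\<lambda>y. \<Psi> y \<bullet> b) has_derivative (\<lambda>u. R (\<Psi> y) u \<bullet> b)) (at y)" if "y \<in> W" for y
        by (rule has_derivative_inner_left[OF der\<Psi>[OF that]])
      have "Ck k W (\<lambda>y. u \<bullet> b - (ddir w u (\<Psi> y) - u \<bullet> v) * inverse (ddir w v (\<Psi> y)) * (v \<bullet> b))" for u
        by (rule Ck_diff[OF Ck_const Ck_mult[OF Ck_mult[OF Ck_diff[OF comp Ck_const] Ck_inverse[OF comp]] Ck_const]])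
          (use \<Psi> in \<open>auto simp: U1_def\<close>)
      then show "Ck k W (\<lambda>y. R (\<Psi> y) u \<bullet> b)" for u
        by (simp add: R_def inner_diff_left)
    qed
  qed
  then have "Cinf W (\<lambda>y. \<Psi> y \<bullet> b)" for b by (simp add: Cinf_def)
  then show thesis
    using that[OF IFT(1,3) _ IFT(4) IFT(6)[unfolded \<Phi>_def[abs_def]]] IFT(2) \<open>U1 \<subseteq> U\<close> der\<Psi>
    unfolding R_def[abs_def] by blast
qed

section \<open>Critical values, by induction on the dimension\<close>

text \<open>The critical points of the restriction of \<open>f\<close> to the subspace
  \<open>V\<close>, with \<open>f\<close> kept as a function on an open set of the whole
  space.\<close>

definition crit_in :: "'e::euclidean_space set \<Rightarrow> 'e set \<Rightarrow> ('e \<Rightarrow> real) \<Rightarrow> 'e set" where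
  "crit_in V U f = {x \<in> U \<inter> V. \<forall>v\<in>V. ddir f v x = 0}"

text \<open>Near a point of the set, \<open>\<Phi>\<close> carries the hypersurface
  \<open>w = 0\<close> in \<open>V\<close> into the hyperplane of \<open>V\<close> orthogonal to
  \<open>v\<close>. Critical points of \<open>f\<close> there become critical points of
  \<open>F\<close>, the composite of \<open>f\<close> with the inverse of \<open>\<Phi>\<close>, so
  \<open>IH\<close> covers their values.\<close>

lemma negligible_image_crit_hypersurface:
  fixes f w :: "'e::euclidean_space \<Rightarrow> real"
  assumes V: "subspace V" and U: "open U" and f: "Cinf U f" and w: "Cinf U w"
    and v: "v \<in> V" "norm v = 1"
    and IH: "\<And>W F. open W \<Longrightarrow> Cinf W F \<Longrightarrow> negligible (F ` crit_in {y \<in> V. y \<bullet> v = 0} W F)"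
  shows "negligible (f ` {x \<in> crit_in V U f. w x = 0 \<and> ddir w v x \<noteq> 0})" (is "negligible (f ` ?Z)")
proof (rule negligible_image_if_locally)
  fix x assume "x \<in> ?Z"
  then have x: "x \<in> U" "ddir w v x \<noteq> 0" by (auto simp: crit_in_def)
  define \<Phi> where "\<Phi> y = y + (w y - y \<bullet> v) *\<^sub>R v" for y
  obtain U' W \<Psi> where U': "open U'" "x \<in> U'" "U' \<subseteq> U" "open W"
    and hom: "homeomorphism U' W \<Phi> \<Psi>"
    and C\<Psi>: "\<And>b. Cinf W (\<lambda>y. \<Psi> y \<bullet> b)"
    and der: "\<And>y. y \<in> W \<Longrightarrow> (\<Psi> has_derivative
       (\<lambda>u. u - ((ddir w u (\<Psi> y) - u \<bullet> v) * inverse (ddir w v (\<Psi> y))) *\<^sub>R v)) (at y)"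
    unfolding \<Phi>_def by (rule rank_one_local_inverse[OF U w x(1) v(2) x(2)]) blast
  have img: "\<Psi> ` W \<subseteq> U" using hom U'(3) by (auto simp: homeomorphism_def)
  define F where "F y = f (\<Psi> y)" for y
  have F: "Cinf W F"
    unfolding Cinf_def F_def using Ck_compose[OF \<open>open W\<close> img] f C\<Psi> by (simp add: Cinf_def)
  have vv: "v \<bullet> v = 1" using v(2) by (simp add: norm_eq_1)
  have "f ` (?Z \<inter> U') \<subseteq> F ` crit_in {y \<in> V. y \<bullet> v = 0} W F"
  proof
    fix a assume "a \<in> f ` (?Z \<inter> U')"
    then obtain y where y: "y \<in> ?Z" "y \<in> U'" "a = f y" by auto
    have yW: "\<Phi> y \<in> W" and \<Psi>\<Phi>: "\<Psi> (\<Phi> y) = y" using hom y(2) by (auto simp: homeomorphism_def)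
    have yV: "y \<in> V" "w y = 0" "y \<in> U" and crit: "\<And>u. u \<in> V \<Longrightarrow> ddir f u y = 0"
      using y(1) by (auto simp: crit_in_def)
    \<comment> \<open>The inner product of \<open>\<Phi> y\<close> with \<open>v\<close> is
      \<open>w y\<close>, which is 0 here.\<close>
    have "\<Phi> y \<in> {y \<in> V. y \<bullet> v = 0}"
      using yV v(1) vv V
      by (auto simp: \<Phi>_def inner_diff_left intro!: subspace_diff subspace_scale)
    moreover have "ddir F u (\<Phi> y) = 0" if "u \<in> V" for u
    proof -
      \<comment> \<open>The derivative of \<open>\<Psi>\<close> at \<open>\<Phi> y\<close>. It
        changes a vector only by a multiple of \<open>v\<close>, so it maps \<open>V\<close> into
        itself, where \<open>f\<close> has zero derivative.\<close>
      define r where "r u = u - ((ddir w u y - u \<bullet> v) * inverse (ddir w v y)) *\<^sub>R v" for u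
      have "(\<Psi> has_derivative r) (at (\<Phi> y))" using der[OF yW] by (simp add: \<Psi>\<Phi> r_def[abs_def])
      moreover have "(f has_derivative (\<lambda>u. ddir f u y)) (at (\<Psi> (\<Phi> y)))"
        using Cinf_has_derivative[OF f yV(3)] by (simp add: \<Psi>\<Phi>)
      ultimately have "(F has_derivative (\<lambda>u. ddir f (r u) y)) (at (\<Phi> y))"
        unfolding F_def[abs_def] by (rule has_derivative_compose)
      with Cinf_has_derivative[OF F yW] have "(\<lambda>u. ddir F u (\<Phi> y)) = (\<lambda>u. ddir f (r u) y)"
        by (rule has_derivative_unique)
      then have "ddir F u (\<Phi> y) = ddir f (r u) y" by (rule fun_cong)
      moreover have "r u \<in> V" unfolding r_def using that v(1) V by (auto intro!: subspace_diff subspace_scale)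
      ultimately show ?thesis using crit by simp
    qed
    ultimately have "\<Phi> y \<in> crit_in {y \<in> V. y \<bullet> v = 0} W F" using yW by (auto simp: crit_in_def)
    moreover have "a = F (\<Phi> y)" by (simp add: F_def \<Psi>\<Phi> y(3))
    ultimately show "a \<in> F ` crit_in {y \<in> V. y \<bullet> v = 0} W F" by blast
  qed
  then have "negligible (f ` (?Z \<inter> U'))" using IH[OF \<open>open W\<close> F] negligible_subset by blast
  with U' show "\<exists>N. open N \<and> x \<in> N \<and> negligible (f ` (?Z \<inter> N))" by blast
qed

text \<open>At a zero of \<open>w\<close> that is not flat, either some first derivative is nonzero,
  and \<open>neg\<close> applies to \<open>w\<close>, or some \<open>ddir w b\<close> vanishes and
  fails to be flat of one order less, and induction applies to that derivative.\<close>

lemma negligible_image_nonflat: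
  assumes "finite B" and U: "open U"
    and neg: "\<And>w b. Cinf U w \<Longrightarrow> b \<in> B \<Longrightarrow> negligible (f ` {x \<in> C. w x = 0 \<and> ddir w b x \<noteq> 0})"
  shows "Cinf U w \<Longrightarrow> negligible (f ` {x \<in> C. w x = 0 \<and> \<not> flat B k w x})"
proof (induction k arbitrary: w)
  case (Suc k)
  have "f ` {x \<in> C. w x = 0 \<and> \<not> flat B (Suc k) w x} \<subseteq>
     (\<Union>b\<in>B. f ` {x \<in> C. w x = 0 \<and> ddir w b x \<noteq> 0} \<union> f ` {x \<in> C. ddir w b x = 0 \<and> \<not> flat B k (ddir w b) x})"
    by auto
  moreover have "negligible \<dots>"
    using assms(1) neg[OF Suc.prems] Suc.IH[OF Cinf_ddir[OF U Suc.prems]] by (intro negligible_Union negligible_Un) auto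
  ultimately show ?case by (rule negligible_subset[rotated])
qed auto

text \<open>The subspace \<open>V\<close> plays the role of the domain, which allows induction on its dimension inside
  a fixed type.\<close>

theorem sard_real_subspace:
  fixes f :: "'e::euclidean_space \<Rightarrow> real"
  assumes "subspace V" "open U" "Cinf U f"
  shows "negligible (f ` crit_in V U f)"
  using assms
proof (induction "dim V" arbitrary: V U f rule: less_induct)
  case less
  note V = less.prems(1) and U = less.prems(2) and f = less.prems(3)
  obtain B where B: "B \<subseteq> V" "pairwise orthogonal B" "\<And>b. b \<in> B \<Longrightarrow> norm b = 1"
    "independent B" "card B = dim V" "span B = V"
    using orthonormal_basis_subspace[OF V] by metis
  have finB: "finite B" using B(4) independent_imp_finite by blast
  \<comment> \<open>The induction hypothesis is used on the orthogonal complement of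
    \<open>b\<close> in \<open>V\<close>, whose dimension is smaller.\<close>
  have hyp: "negligible (f ` {x \<in> crit_in V U f. w x = 0 \<and> ddir w b x \<noteq> 0})" if w: "Cinf U w" and b: "b \<in> B" for w b
  proof (rule negligible_image_crit_hypersurface[OF V U f w])
    show bV: "b \<in> V" and nb: "norm b = 1" using b B by auto
    define V' where "V' = {y \<in> V. y \<bullet> b = 0}"
    have sV': "subspace V'" using V unfolding V'_def subspace_def by (auto simp: inner_left_distrib)
    have "b \<notin> V'" using nb by (auto simp: V'_def norm_eq_1)
    moreover have "V' \<subseteq> V" by (auto simp: V'_def)
    ultimately have "V' \<subset> V" using bV by blast
    then have "dim V' < dim V" by (intro dim_psubset) (simp add: span_eq_iff[THEN iffD2] sV' V)
    then show "negligible (F ` crit_in {y \<in> V. y \<bullet> b = 0} W F)" if "open W" "Cinf W F" for W F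
      using less.hyps[of V'] sV' that unfolding V'_def by blast
  qed
  \<comment> \<open>With the order \<open>Suc (dim V)\<close>, a critical point outside
    \<open>D\<close> has some \<open>ddir f b\<close> that is not flat of order
    \<open>dim V\<close>. On \<open>D\<close>, flatness of order \<open>dim V\<close> yields the
    exponent \<open>Suc (dim V)\<close>, which exceeds the dimension.\<close>
  define D where "D = {x \<in> crit_in V U f. flat B (Suc (dim V)) f x}"
  have "negligible (f ` D)"
  proof (rule negligible_image_if_locally)
    fix x assume "x \<in> D"
    then have "x \<in> U" by (auto simp: D_def crit_in_def)
    then obtain r where r: "r > 0" "cball x r \<subseteq> U" using U open_contains_cball by blast
    define \<rho> where "\<rho> = min r 1"
    have \<rho>: "\<rho> > 0" "\<rho> \<le> 1" "cball x \<rho> \<subseteq> U" using r by (auto simp: \<rho>_def)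
    define K where "K = cball x \<rho> \<inter> V"
    have K: "compact K" "convex K" "K \<subseteq> U" "K \<subseteq> span B"
      using \<rho>(3) B(6) compact_Int_closed[OF compact_cball closed_subspace[OF V]]
        convex_Int[OF convex_cball subspace_imp_convex[OF V]]
      by (auto simp: K_def)
    obtain M where M: "M \<ge> 0" "\<And>x y. x \<in> K \<Longrightarrow> flat B (dim V) f x \<Longrightarrow> y \<in> K \<Longrightarrow> \<bar>f y - f x\<bar> \<le> M * norm (y - x) ^ Suc (dim V)"
      using flat_increment_bound[OF finB B(2,3) U K f, of "dim V"] by blast
    have flat_mono: "flat B (Suc k) g z \<Longrightarrow> flat B k g z" for k g z
      by (induction k arbitrary: g) auto
    have "negligible (f ` (D \<inter> ball x \<rho>))"
    proof (rule negligible_image_Hoelder[OF finB B(2,3) _ _ M(1)])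
      show "D \<inter> ball x \<rho> \<subseteq> cball x 1" using \<rho> by auto
      show "D \<inter> ball x \<rho> \<subseteq> span B" using B(6) by (auto simp: D_def crit_in_def)
      show "\<bar>f z - f y\<bar> \<le> M * norm (z - y) ^ Suc (card B)" if "y \<in> D \<inter> ball x \<rho>" "z \<in> D \<inter> ball x \<rho>" for y z
      proof -
        have "y \<in> K" "z \<in> K" using that by (auto simp: K_def D_def crit_in_def)
        moreover have "flat B (dim V) f y" using that flat_mono unfolding D_def by blast
        ultimately show ?thesis using M(2) B(5) by simp
      qed
    qed
    then show "\<exists>N. open N \<and> x \<in> N \<and> negligible (f ` (D \<inter> N))" using \<rho>(1) by (metis centre_in_ball open_ball)
  qed
  moreover have "negligible (\<Union>b\<in>B. f ` {x \<in> crit_in V U f. ddir f b x = 0 \<and> \<not> flat B (dim V) (ddir f b) x})"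
    using finB negligible_image_nonflat[OF finB U hyp Cinf_ddir[OF U f]] by (intro negligible_Union) auto
  \<comment> \<open>Since \<open>B\<close> lies in \<open>V\<close>, all \<open>ddir f b\<close>
    vanish at a critical point, so failure of flatness must come from a higher order.\<close>
  moreover have "f ` crit_in V U f \<subseteq> f ` D \<union>
      (\<Union>b\<in>B. f ` {x \<in> crit_in V U f. ddir f b x = 0 \<and> \<not> flat B (dim V) (ddir f b) x})"
  proof -
    have "crit_in V U f \<subseteq> D \<union>
      (\<Union>b\<in>B. {x \<in> crit_in V U f. ddir f b x = 0 \<and> \<not> flat B (dim V) (ddir f b) x})"
      using B(1) by (auto simp: D_def crit_in_def)
    from image_mono[OF this, of f] show ?thesis by (simp only: image_Un image_UN)
  qed
  ultimately show ?case by (meson negligible_Un negligible_subset)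
qed

section \<open>The radical of a local algebra\<close>

lemma ideal_of_mult: "ideal_of I \<Longrightarrow> x \<in> I \<Longrightarrow> a * x \<in> I"
  by (simp add: ideal_of_def)

lemma ideal_of_add: "ideal_of I \<Longrightarrow> x \<in> I \<Longrightarrow> y \<in> I \<Longrightarrow> x + y \<in> I"
  by (simp add: ideal_of_def)

text \<open>A real scalar \<open>r\<close> acts as multiplication by \<open>r *\<^sub>R 1\<close>.
  This makes dimension counts available for ideals.\<close>

lemma ideal_of_subspace:
  fixes I :: "'a::{real_algebra_1,comm_ring_1} set"
  assumes "ideal_of I"
  shows "subspace I"
proof -
  have "r *\<^sub>R x \<in> I" if "x \<in> I" for r x
  proof -
    have "(r *\<^sub>R 1) * x \<in> I" using assms that by (rule ideal_of_mult)
    then show ?thesis by simp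
  qed
  then show ?thesis using assms by (simp add: ideal_of_def subspace_def)
qed

lemma ideal_of_principal: "ideal_of (range (\<lambda>y. u * y))" for u :: "'a::comm_ring_1"
  unfolding ideal_of_def
proof (intro conjI ballI allI impI)
  show "0 \<in> range ((*) u)" by (metis mult_zero_right rangeI)
  show "x + y \<in> range ((*) u)" if "x \<in> range ((*) u)" "y \<in> range ((*) u)" for x y
    using that by (auto simp: distrib_left[symmetric])
  show "a * x \<in> range ((*) u)" if "x \<in> range ((*) u)" for a x
  proof -
    from that obtain y where "x = u * y" by blast
    then have "a * x = u * (a * y)" by (simp add: mult_ac)
    then show ?thesis by blast
  qed
qed

text \<open>A proper ideal of greatest dimension among those containing \<open>J\<close> is maximal;
  finite dimension replaces Zorn's lemma.\<close>

lemma ideal_of_subset_maximal_ideal: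
  fixes J :: "'a::{euclidean_space,real_algebra_1,comm_ring_1} set"
  assumes "ideal_of J" "J \<noteq> UNIV"
  shows "\<exists>I. maximal_ideal I \<and> J \<subseteq> I"
proof -
  define P where "P I \<longleftrightarrow> ideal_of I \<and> I \<noteq> UNIV \<and> J \<subseteq> I" for I
  have "P J" using assms by (simp add: P_def)
  then obtain I where I: "P I" "\<And>I'. P I' \<Longrightarrow> dim I' \<le> dim I"
    using ex_has_greatest_nat[of P J dim "DIM('a) + 1"] dim_subset_UNIV[where ?'a='a]
    by (metis le_imp_less_Suc Suc_eq_plus1)
  have "J' = I" if "ideal_of J'" "I \<subseteq> J'" "J' \<noteq> UNIV" for J'
  proof -
    have "P J'" using that I(1) by (auto simp: P_def)
    then have "dim J' \<le> dim I" by (rule I(2))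
    moreover have "subspace I" "subspace J'"
      using I(1) that(1) by (auto simp: P_def ideal_of_subspace)
    ultimately show ?thesis using subspace_dim_equal[of I J'] that(2) by simp
  qed
  then have "maximal_ideal I" using I(1) by (auto simp: maximal_ideal_def P_def)
  then show ?thesis using I(1) by (auto simp: P_def)
qed

lemma maximal_ideal_rad:
  assumes "is_local TYPE('a::comm_ring_1)"
  shows "maximal_ideal (rad :: 'a set)"
  unfolding rad_def by (rule theI'[of maximal_ideal]) (use assms in \<open>simp add: is_local_def\<close>)

lemma ideal_of_rad: "is_local TYPE('a::comm_ring_1) \<Longrightarrow> ideal_of (rad :: 'a set)"
  using maximal_ideal_rad by (auto simp: maximal_ideal_def)

lemma one_notin_rad:
  assumes "is_local TYPE('a::comm_ring_1)"
  shows "(1::'a) \<notin> rad"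
proof
  assume "(1::'a) \<in> rad"
  then have "a * 1 \<in> rad" for a :: 'a
    by (rule ideal_of_mult[OF ideal_of_rad[OF assms]])
  then have "(rad :: 'a set) = UNIV" by auto
  then show False using maximal_ideal_rad[OF assms] by (simp add: maximal_ideal_def)
qed

text \<open>A non-unit generates a proper ideal, which lies in a maximal ideal, and the only one is
  \<open>rad\<close>.\<close>

lemma not_in_rad_imp_unit:
  fixes u :: "'a::{euclidean_space,real_algebra_1,comm_ring_1}"
  assumes loc: "is_local TYPE('a)" and "u \<notin> rad"
  shows "\<exists>y. u * y = 1"
proof (rule ccontr)
  assume "\<nexists>y. u * y = 1"
  then have "range (\<lambda>y. u * y) \<noteq> UNIV" by (metis UNIV_I rangeE)
  then obtain I where I: "maximal_ideal I" "range (\<lambda>y. u * y) \<subseteq> I"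
    using ideal_of_subset_maximal_ideal[OF ideal_of_principal] by blast
  have "\<exists>!I::'a set. maximal_ideal I" using loc by (simp add: is_local_def)
  then have "I = rad" using I(1) maximal_ideal_rad[OF loc] by blast
  moreover have "u * 1 \<in> I" using I(2) by blast
  ultimately show False using assms(2) by simp
qed

text \<open>The decreasing chain of ideals generated by the powers of \<open>w\<close> becomes
  stationary, so \<open>w ^ k = w ^ Suc k * y\<close> for some \<open>y\<close>. Then
  \<open>w ^ k * (1 - w * y) = 0\<close>, and \<open>1 - w * y\<close> is a unit.\<close>

lemma rad_nilpotent:
  fixes w :: "'a::{euclidean_space,real_algebra_1,comm_ring_1}"
  assumes loc: "is_local TYPE('a)" and w: "w \<in> rad"
  shows "\<exists>k. w ^ k = 0"
proof -
  define I where "I k = range (\<lambda>y. w ^ k * y)" for k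
  have sub: "subspace (I k)" for k
    unfolding I_def by (rule ideal_of_subspace[OF ideal_of_principal])
  obtain k where "\<And>j. dim (I k) \<le> dim (I j)"
    using ex_has_least_nat[of "\<lambda>_. True" 0 "\<lambda>k. dim (I k)"] by blast
  moreover have "I (Suc k) \<subseteq> I k" 
  proof
    fix x assume "x \<in> I (Suc k)"
    then obtain y where "x = w ^ Suc k * y" unfolding I_def by blast
    then have "x = w ^ k * (w * y)" by (simp add: mult_ac)
    then show "x \<in> I k" unfolding I_def by blast
  qed
  ultimately have "I (Suc k) = I k" using subspace_dim_equal[OF sub sub] by blast
  moreover have "w ^ k * 1 \<in> I k" unfolding I_def by blast
  ultimately have "w ^ k \<in> I (Suc k)" by simp
  then obtain y where y: "w ^ k = w ^ Suc k * y" unfolding I_def by auto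
  note id = ideal_of_rad[OF loc]
  have "1 - w * y \<notin> rad"
  proof
    assume "1 - w * y \<in> rad"
    moreover have "y * w \<in> rad" using id w by (rule ideal_of_mult)
    ultimately have "(1 - w * y) + y * w \<in> rad" by (rule ideal_of_add[OF id])
    then show False using one_notin_rad[OF loc] by (simp add: mult.commute)
  qed
  then obtain z where z: "(1 - w * y) * z = 1" using not_in_rad_imp_unit[OF loc] by blast
  have "w ^ k * (1 - w * y) = 0" using y by (simp add: algebra_simps)
  then have "w ^ k * ((1 - w * y) * z) = 0" by (metis mult.assoc mult_zero_left)
  then show ?thesis using z by auto
qed

section \<open>Coordinates in a standard basis\<close>

context
  fixes e :: "nat \<Rightarrow> 'a::{euclidean_space,real_algebra_1,comm_ring_1}"
  assumes e: "standard_basis e"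
begin

lemma standard_basis_coeffs_unique:
  assumes "(\<Sum>k<DIM('a). c k *\<^sub>R e k) = (\<Sum>k<DIM('a). d k *\<^sub>R e k)" "i < DIM('a)"
  shows "c i = d i"
proof -
  have inj: "inj_on e {..<DIM('a)}" and ind: "independent (e ` {..<DIM('a)})"
    using e by (auto simp: standard_basis_def)
  define u where "u v = c (inv_into {..<DIM('a)} e v) - d (inv_into {..<DIM('a)} e v)" for v
  have "(\<Sum>v\<in>e ` {..<DIM('a)}. u v *\<^sub>R v) = (\<Sum>k<DIM('a). (c k - d k) *\<^sub>R e k)"
    by (subst sum.reindex[OF inj]) (auto simp: u_def inv_into_f_f[OF inj] intro!: sum.cong)
  also have "\<dots> = 0" using assms(1) by (simp add: scaleR_diff_left sum_subtractf)
  finally have "u (e i) = 0"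
    using independentD[OF ind, of "e ` {..<DIM('a)}" u "e i"] assms(2) by auto
  then show ?thesis using assms(2) by (simp add: u_def inv_into_f_f[OF inj])
qed

lemma span_standard_basis_image:
  assumes "I \<subseteq> {..<DIM('a)}" "y \<in> span (e ` I)"
  obtains c where "y = (\<Sum>k<DIM('a). c k *\<^sub>R e k)" "\<And>k. k \<notin> I \<Longrightarrow> c k = 0"
proof -
  have inj: "inj_on e I" using e assms(1) inj_on_subset by (auto simp: standard_basis_def)
  have "finite I" using assms(1) finite_subset by blast
  then obtain u where "y = (\<Sum>v\<in>e ` I. u v *\<^sub>R v)"
    using assms(2) by (auto simp: span_finite)
  also have "\<dots> = (\<Sum>k\<in>I. u (e k) *\<^sub>R e k)"
    by (subst sum.reindex[OF inj]) simp
  also have "\<dots> = (\<Sum>k<DIM('a). (if k \<in> I then u (e k) else 0) *\<^sub>R e k)"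
    using assms(1) by (intro sum.mono_neutral_cong_left) auto
  finally show thesis by (rule that) auto
qed

lemma bcoord_eqI:
  assumes "y = (\<Sum>k<DIM('a). c k *\<^sub>R e k)" "i < DIM('a)"
  shows "bcoord e i y = c i"
proof -
  \<comment> \<open>The description in \<open>bcoord\<close> demands coefficients vanishing from
    \<open>DIM('a)\<close> on, hence the truncation of \<open>c\<close>.\<close>
  define d where "d k = (if k < DIM('a) then c k else 0)" for k
  have "(THE c. (\<forall>k\<ge>DIM('a). c k = 0) \<and> y = (\<Sum>k<DIM('a). c k *\<^sub>R e k)) = d"
  proof (rule the_equality)
    have "(\<Sum>k<DIM('a). d k *\<^sub>R e k) = y" unfolding assms(1) by (rule sum.cong) (auto simp: d_def)
    then show d: "(\<forall>k\<ge>DIM('a). d k = 0) \<and> y = (\<Sum>k<DIM('a). d k *\<^sub>R e k)" by (simp add: d_def)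
    fix c' assume c': "(\<forall>k\<ge>DIM('a). c' k = 0) \<and> y = (\<Sum>k<DIM('a). c' k *\<^sub>R e k)"
    show "c' = d"
    proof
      fix k show "c' k = d k"
      proof (cases "k < DIM('a)")
        case True
        with c' d show ?thesis using standard_basis_coeffs_unique[of c' d k] by simp
      next
        case False
        with c' d show ?thesis by simp
      qed
    qed
  qed
  then show ?thesis using assms(2) by (simp add: bcoord_def d_def)
qed

text \<open>The remaining basis vectors span the radical, so the coordinate at
  \<open>e 0 = 1\<close> is the residue class modulo \<open>rad\<close>.\<close>

lemma bcoord_0_eq_iff: "bcoord e 0 a = bcoord e 0 b \<longleftrightarrow> a - b \<in> rad"
proof -
  have rad: "span (e ` {1..<DIM('a)}) = rad" and UNIV: "span (e ` {..<DIM('a)}) = UNIV"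
    using e by (auto simp: standard_basis_def)
  obtain c where c: "a = (\<Sum>k<DIM('a). c k *\<^sub>R e k)"
    using span_standard_basis_image[of "{..<DIM('a)}" a] UNIV by auto
  obtain d where d: "b = (\<Sum>k<DIM('a). d k *\<^sub>R e k)"
    using span_standard_basis_image[of "{..<DIM('a)}" b] UNIV by auto
  have cd: "bcoord e 0 a = c 0" "bcoord e 0 b = d 0"
    using bcoord_eqI[OF c] bcoord_eqI[OF d] by simp_all
  have diff: "a - b = (\<Sum>k<DIM('a). (c k - d k) *\<^sub>R e k)"
    by (simp add: c d scaleR_diff_left sum_subtractf)
  show ?thesis
  proof
    assume "bcoord e 0 a = bcoord e 0 b"
    then have "c 0 - d 0 = 0" by (simp add: cd)
    then have "(c k - d k) *\<^sub>R e k \<in> span (e ` {1..<DIM('a)})" if "k < DIM('a)" for k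
    proof (cases "k = 0")
      case True
      with \<open>c 0 - d 0 = 0\<close> show ?thesis by (simp add: span_zero)
    next
      case False
      with that have "e k \<in> e ` {1..<DIM('a)}" by auto
      then show ?thesis by (intro span_scale span_base)
    qed
    then show "a - b \<in> rad" unfolding diff rad[symmetric] by (intro span_sum) auto
  next
    assume "a - b \<in> rad"
    then have "a - b \<in> span (e ` {1..<DIM('a)})" by (simp only: rad)
    moreover have "{1..<DIM('a)} \<subseteq> {..<DIM('a)}" by auto
    ultimately obtain u where u: "a - b = (\<Sum>k<DIM('a). u k *\<^sub>R e k)" "\<And>k. k \<notin> {1..<DIM('a)} \<Longrightarrow> u k = 0"
      using span_standard_basis_image by blast
    have "c 0 - d 0 = u 0"
      using standard_basis_coeffs_unique[of "\<lambda>k. c k - d k" u 0] u(1) diff by simp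
    then show "bcoord e 0 a = bcoord e 0 b" using u(2)[of 0] by (simp add: cd)
  qed
qed

end

section \<open>Functions on compact manifolds over an algebra\<close>

lemma bounded_linear_mult_algebra:
  fixes w :: "'a::{euclidean_space,real_algebra_1}"
  shows "bounded_linear (\<lambda>y. w * y)"
  unfolding linear_conv_bounded_linear[symmetric]
  by (rule linearI) (simp_all add: distrib_left)

lemma constant_imp_derivative_zero:
  assumes "open S" "x \<in> S" "(f has_derivative L) (at x)" "\<And>y. y \<in> S \<Longrightarrow> f y = c"
  shows "L v = 0"
proof -
  have "((\<lambda>_. c) has_derivative L) (at x)"
    using assms by (auto intro: has_derivative_transform_within_open)
  then have "L = (\<lambda>_. 0)" using has_derivative_const has_derivative_unique by blast
  then show ?thesis by simp
qed

text \<open>Two distinct values would force the connected range to contain an interval of positive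
  length.\<close>

lemma real_constant_if_negligible_range:
  fixes f :: "'m::topological_space \<Rightarrow> real"
  assumes "connected (UNIV :: 'm set)" "continuous_on UNIV f" "negligible (range f)"
  shows "f x = f y"
proof -
  have False if "f x < f y" for x y
  proof -
    have "{f x..f y} \<subseteq> range f"
      using connected_contains_Icc[OF connected_continuous_image[OF assms(2,1)]] by blast
    then have "negligible {f x<..<f y}"
      using assms(3) greaterThanLessThan_subseteq_atLeastAtMost_iff by (meson negligible_subset order_refl order_trans)
    then show False using that open_not_negligible[of "{f x<..<f y}"] by simp
  qed
  then show ?thesis by (meson linorder_neqE)
qed

lemma chartD:
  assumes "A_manifold_atlas \<A>" "(U, \<phi>) \<in> \<A>"
  shows "open U" "open (\<phi> ` U)" "inj_on \<phi> U" "continuous_on U \<phi>"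
  using assms by (auto simp: A_manifold_atlas_def is_chart_def)

lemma atlas_covers:
  assumes "A_manifold_atlas \<A>"
  obtains U \<phi> where "(U, \<phi>) \<in> \<A>" "p \<in> U"
proof -
  have "p \<in> \<Union>(fst ` \<A>)" using assms by (simp add: A_manifold_atlas_def)
  then show thesis using that by auto
qed

lemma A_differentiable_chartD:
  assumes "A_differentiable \<A> G" "(U, \<phi>) \<in> \<A>"
  shows "smooth_on (\<phi> ` U) (G \<circ> inv_into U \<phi>)"
    and "x \<in> \<phi> ` U \<Longrightarrow> \<exists>L. ((G \<circ> inv_into U \<phi>) has_derivative L) (at x) \<and> A_linear_fun L"
  using assms by (auto simp: A_differentiable_def)

lemma A_differentiable_continuous:
  fixes G :: "'m::t2_space \<Rightarrow> 'a::{euclidean_space,real_algebra_1,comm_ring_1}"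
  assumes A: "A_manifold_atlas \<A>" and G: "A_differentiable \<A> G"
  shows "continuous_on UNIV G"
proof -
  have "isCont G p" for p
  proof -
    obtain U \<phi> where c: "(U, \<phi>) \<in> \<A>" "p \<in> U" using atlas_covers[OF A] .
    note ch = chartD[OF A c(1)]
    have "continuous_on (\<phi> ` U) (G \<circ> inv_into U \<phi>)"
      using A_differentiable_chartD(2)[OF G c(1)]
      by (meson continuous_at_imp_continuous_on has_derivative_continuous)
    then have "continuous_on U (\<lambda>y. (G \<circ> inv_into U \<phi>) (\<phi> y))"
      using ch(4) by (rule continuous_on_compose2) auto
    then have "continuous_on U G"
      by (rule continuous_on_eq) (simp add: inv_into_f_f[OF ch(3)])
    then show ?thesis using c(2) ch(1) continuous_on_eq_continuous_at by blast
  qed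
  then show ?thesis by (simp add: continuous_at_imp_continuous_on)
qed

section \<open>Constancy of multiples by radical elements\<close>

lemma mult_square_constant_imp_mult_constant:
  fixes \<A> :: "('m::{t2_space,second_countable_topology}, 'a::{euclidean_space,real_algebra_1,comm_ring_1}, 'k::finite) chart set"
    and G :: "'m \<Rightarrow> 'a"
  assumes A: "A_manifold_atlas \<A>" and cpt: "compact (UNIV :: 'm set)" and conn: "connected (UNIV :: 'm set)"
    and G: "A_differentiable \<A> G" and ww: "\<And>x y. w * w * G x = w * w * G y"
  shows "w * G x = w * G y"
proof (rule euclidean_eqI)
  fix b :: 'a assume "b \<in> Basis"
  \<comment> \<open>The functional \<open>\<mu>\<close> is the inner product with the basis vector
    \<open>b\<close>, and \<open>T\<close> is \<open>\<mu>\<close> after multiplication by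
    \<open>w\<close>.\<close>
  define T where "T y = (w * y) \<bullet> b" for y
  have T: "bounded_linear T"
    unfolding T_def[abs_def] by (rule bounded_linear_inner_left[THEN bounded_linear_compose, OF bounded_linear_mult_algebra])
  define f where "f x = T (G x)" for x
  note contG = A_differentiable_continuous[OF A G]
  have contf: "continuous_on UNIV f"
    unfolding f_def by (rule bounded_linear.continuous_on[OF T contG])
  \<comment> \<open>Criticality is required in every chart around the point, so that no independence
    of the chart has to be shown: the Sard argument picks one chart, and the maximum argument works
    in an arbitrary one.\<close>
  define Crit where "Crit = {p. \<forall>(U, \<phi>)\<in>\<A>. p \<in> U \<longrightarrow>
      \<phi> p \<in> crit_in UNIV (\<phi> ` U) (\<lambda>z. T ((G \<circ> inv_into U \<phi>) z))}"
  have smooth: "Cinf (\<phi> ` U) (\<lambda>z. S ((G \<circ> inv_into U \<phi>) z))"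
    if "(U, \<phi>) \<in> \<A>" "bounded_linear S" for U \<phi> and S :: "'a \<Rightarrow> real"
    using smooth_on_imp_Cinf[OF A_differentiable_chartD(1)[OF G that(1)] that(2)] .
  have "negligible (f ` Crit)"
  proof (rule negligible_image_if_locally)
    fix p assume "p \<in> Crit"
    obtain U \<phi> where c: "(U, \<phi>) \<in> \<A>" "p \<in> U" using atlas_covers[OF A] .
    note ch = chartD[OF A c(1)]
    let ?f = "\<lambda>z. T ((G \<circ> inv_into U \<phi>) z)"
    have "f ` (Crit \<inter> U) \<subseteq> ?f ` crit_in UNIV (\<phi> ` U) ?f"
    proof
      fix a assume "a \<in> f ` (Crit \<inter> U)"
      then obtain q where q: "q \<in> Crit" "q \<in> U" "a = f q" by auto
      then have "\<phi> q \<in> crit_in UNIV (\<phi> ` U) ?f" using c(1) by (auto simp: Crit_def)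
      moreover have "a = ?f (\<phi> q)" using q by (simp add: f_def inv_into_f_f[OF ch(3)])
      ultimately show "a \<in> ?f ` crit_in UNIV (\<phi> ` U) ?f" by blast
    qed
    moreover have "negligible (?f ` crit_in UNIV (\<phi> ` U) ?f)"
      by (rule sard_real_subspace[OF subspace_UNIV ch(2) smooth[OF c(1) T]])
    ultimately have "negligible (f ` (Crit \<inter> U))" using negligible_subset by blast
    then show "\<exists>N. open N \<and> p \<in> N \<and> negligible (f ` (Crit \<inter> N))" using c(2) ch(1) by blast
  qed
  moreover have "range f \<subseteq> f ` Crit"
  proof
    fix a assume "a \<in> range f"
    then obtain p0 where p0: "a = f p0" by blast
    define K where "K = {x. f x = a}"
    have "closed K" unfolding K_def
      using contf by (intro closed_Collect_eq) (auto intro: continuous_intros)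
    then have "compact K" using compact_Int_closed[OF cpt] by auto
    moreover have "p0 \<in> K" by (simp add: K_def p0)
    moreover have "continuous_on K (\<lambda>x. G x \<bullet> b)"
      using continuous_on_subset[OF contG] by (intro continuous_intros) auto
    ultimately obtain p where p: "p \<in> K" "\<And>y. y \<in> K \<Longrightarrow> G y \<bullet> b \<le> G p \<bullet> b"
      using continuous_attains_sup[of K "\<lambda>x. G x \<bullet> b"] by blast
    have "p \<in> Crit"
      unfolding Crit_def
    proof (clarify)
      fix U and \<phi> :: "'m \<Rightarrow> 'a ^ 'k" assume c: "(U, \<phi>) \<in> \<A>" and pU: "p \<in> U"
      note ch = chartD[OF A c]
      define g where "g = G \<circ> inv_into U \<phi>"
      let ?\<Omega> = "\<phi> ` U"
      have z: "\<phi> p \<in> ?\<Omega>" using pU by blast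
      have gp: "g (\<phi> p) = G p" using pU by (simp add: g_def inv_into_f_f[OF ch(3)])
      have Cf: "Cinf ?\<Omega> (\<lambda>z. T (g z))" unfolding g_def by (rule smooth[OF c T])
      have Ch: "Cinf ?\<Omega> (\<lambda>z. g z \<bullet> b)" unfolding g_def by (rule smooth[OF c bounded_linear_inner_left])
      \<comment> \<open>One \<open>A\<close>-linear \<open>L\<close>, the derivative of
        \<open>g\<close>, computes both directional derivatives; differentiating the constant
        \<open>w * w * G\<close> gives \<open>w * w * L u = 0\<close>.\<close>
      have dd: "\<exists>L. A_linear_fun L \<and> (\<forall>u. ddir (\<lambda>z. T (g z)) u z = T (L u)) \<and>
           (\<forall>u. ddir (\<lambda>z. g z \<bullet> b) u z = L u \<bullet> b) \<and> (\<forall>u. w * w * L u = 0)" if z': "z \<in> ?\<Omega>" for z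
      proof -
        obtain L where L: "(g has_derivative L) (at z)" "A_linear_fun L"
          using A_differentiable_chartD(2)[OF G c z'] unfolding g_def by blast
        have "ddir (\<lambda>z. T (g z)) u z = T (L u)" for u
          using has_derivative_unique[OF Cinf_has_derivative[OF Cf z'] bounded_linear.has_derivative[OF T L(1)]]
          by (rule fun_cong)
        moreover have "ddir (\<lambda>z. g z \<bullet> b) u z = L u \<bullet> b" for u
          using has_derivative_unique[OF Cinf_has_derivative[OF Ch z'] has_derivative_inner_left[OF L(1)]]
          by (rule fun_cong)
        moreover have "w * w * L u = 0" for u
          by (rule constant_imp_derivative_zero[OF ch(2) z'
                bounded_linear.has_derivative[OF bounded_linear_mult_algebra L(1)], where c = "w * w * G p"])
            (simp only: g_def o_def, rule ww)
        ultimately show ?thesis using L(2) by blast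
      qed
      have "ddir (\<lambda>z. T (g z)) v (\<phi> p) = 0" for v
      proof -
        \<comment> \<open>In this direction \<open>T (L u)\<close> is the \<open>b\<close>-component
          of \<open>w * w * L v\<close>, hence 0. The line through \<open>\<phi> p\<close> along
          \<open>u\<close> therefore stays in the level set \<open>K\<close> for small
          \<open>t\<close>.\<close>
        define u where "u = ascale w v"
        have "open ((\<lambda>t::real. \<phi> p + t *\<^sub>R u) -` ?\<Omega>)"
          by (intro open_vimage ch(2) continuous_intros)
        moreover have "0 \<in> (\<lambda>t::real. \<phi> p + t *\<^sub>R u) -` ?\<Omega>" using z by simp
        ultimately obtain \<delta> where \<delta>: "\<delta> > 0" "ball 0 \<delta> \<subseteq> (\<lambda>t::real. \<phi> p + t *\<^sub>R u) -` ?\<Omega>"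
          using open_contains_ball by blast
        then have line: "\<phi> p + t *\<^sub>R u \<in> ?\<Omega>" if "t \<in> ball 0 \<delta>" for t using that by blast
        have "((\<lambda>t. T (g (\<phi> p + t *\<^sub>R u))) has_real_derivative 0) (at t within ball 0 \<delta>)" if "t \<in> ball 0 \<delta>" for t
        proof -
          obtain L where L: "A_linear_fun L" "\<And>s. ddir (\<lambda>z. T (g z)) s (\<phi> p + t *\<^sub>R u) = T (L s)"
            "\<And>s. w * w * L s = 0"
            using dd[OF line[OF \<open>t \<in> ball 0 \<delta>\<close>]] by blast
          have "T (L u) = (w * w * L v) \<bullet> b"
            using L(1) by (simp add: T_def u_def A_linear_fun_def mult.assoc)
          then have "ddir (\<lambda>z. T (g z)) u (\<phi> p + t *\<^sub>R u) = 0" using L(2,3) by simp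
          then show ?thesis
            using Cinf_DERIV_line[OF Cf line[OF that]] by (simp add: has_field_derivative_at_within)
        qed
        then have "\<exists>k. \<forall>t\<in>ball 0 \<delta>. T (g (\<phi> p + t *\<^sub>R u)) = k"
          by (rule has_field_derivative_zero_constant[OF convex_ball])
        then obtain k where k: "\<And>t. t \<in> ball 0 \<delta> \<Longrightarrow> T (g (\<phi> p + t *\<^sub>R u)) = k"
          by blast
        have "k = a"
          using k[of 0] \<delta>(1) p(1) gp by (simp add: K_def f_def)
        have le: "g (\<phi> p + t *\<^sub>R u) \<bullet> b \<le> g (\<phi> p + 0 *\<^sub>R u) \<bullet> b" if "\<bar>0 - t\<bar> < \<delta>" for t
        proof -
          have t: "t \<in> ball 0 \<delta>" using that by (simp add: dist_real_def)
          have "inv_into U \<phi> (\<phi> p + t *\<^sub>R u) \<in> K"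
            using k[OF t] \<open>k = a\<close> by (simp add: K_def f_def g_def)
          from p(2)[OF this] show ?thesis using gp by (simp add: g_def)
        qed
        \<comment> \<open>The parameter \<open>0\<close> is a local maximum of the
          \<open>b\<close>-component of \<open>g\<close> along the line. By
          \<open>A\<close>-linearity the vanishing derivative is the \<open>b\<close>-component of
          \<open>w * L v\<close>, that is, the derivative of \<open>T (g z)\<close> in direction
          \<open>v\<close>.\<close>
        have "ddir (\<lambda>z. g z \<bullet> b) u (\<phi> p + 0 *\<^sub>R u) = 0"
          by (rule DERIV_local_max[OF Cinf_DERIV_line[OF Ch] \<delta>(1)]) (use le z in auto)
        moreover obtain L where L: "A_linear_fun L" "\<And>u. ddir (\<lambda>z. T (g z)) u (\<phi> p) = T (L u)"
            "\<And>u. ddir (\<lambda>z. g z \<bullet> b) u (\<phi> p) = L u \<bullet> b"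
          using dd[OF z] by blast
        ultimately have "L u \<bullet> b = 0" by simp
        then show ?thesis using L(1,2) by (simp add: T_def u_def A_linear_fun_def)
      qed
      then show "\<phi> p \<in> crit_in UNIV (\<phi> ` U) (\<lambda>z. T ((G \<circ> inv_into U \<phi>) z))"
        using z by (auto simp: crit_in_def g_def)
    qed
    then show "a \<in> f ` Crit" using p(1) by (auto simp: K_def)
  qed
  ultimately have "negligible (range f)" using negligible_subset by blast
  from real_constant_if_negligible_range[OF conn contf this]
  show "(w * G x) \<bullet> b = (w * G y) \<bullet> b" by (simp add: f_def T_def)
qed

text \<open>A power of \<open>w\<close> with exponent \<open>2 ^ n\<close> vanishes, so its product
  with \<open>G\<close> is constant. Taking square roots of the factor \<open>n\<close> times leads
  down to \<open>w\<close>.\<close>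

lemma rad_mult_constant:
  fixes \<A> :: "('m::{t2_space,second_countable_topology}, 'a::{euclidean_space,real_algebra_1,comm_ring_1}, 'k::finite) chart set"
    and G :: "'m \<Rightarrow> 'a"
  assumes loc: "is_local TYPE('a)"
    and A: "A_manifold_atlas \<A>" and cpt: "compact (UNIV :: 'm set)" and conn: "connected (UNIV :: 'm set)"
    and G: "A_differentiable \<A> G" and w: "w \<in> rad"
  shows "w * G x = w * G y"
proof -
  obtain n where "w ^ n = 0" using rad_nilpotent[OF loc w] by blast
  moreover have "n \<le> 2 ^ n" by (simp add: less_imp_le)
  ultimately have "w ^ (2 ^ n) = 0" by (metis le_add_diff_inverse mult_zero_left power_add)
  then have "w ^ (2 ^ n) * G x = w ^ (2 ^ n) * G y" for x y by simp
  moreover have "(\<And>x y. w ^ (2 ^ n) * G x = w ^ (2 ^ n) * G y) \<Longrightarrow> w * G x = w * G y" for x y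
  \<comment> \<open>Generalising \<open>w\<close> lets the hypothesis be used for
    \<open>w * w\<close>, whose power with exponent \<open>2 ^ n\<close> is that of \<open>w\<close>
    with exponent \<open>2 ^ Suc n\<close>.\<close>
  proof (induction n arbitrary: w x y)
    case (Suc n)
    have "(w * w) ^ (2 ^ n) = w ^ (2 ^ Suc n)" by (simp add: power_mult power2_eq_square)
    then have "w * w * G x = w * w * G y" for x y using Suc.IH[of "w * w"] Suc.prems by simp
    then show ?case by (rule mult_square_constant_imp_mult_constant[OF A cpt conn G])
  qed simp
  ultimately show ?thesis by blast
qed

section \<open>Constancy along leaves\<close>

text \<open>Expanding \<open>u\<close> in the standard \<open>A\<close>-basis,
  \<open>A\<close>-linearity pulls out the coefficients, which lie in the radical and annihilate the
  values of \<open>L\<close>.\<close>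

lemma A_linear_fun_zero_on_rad:
  fixes L :: "'a::{euclidean_space,real_algebra_1,comm_ring_1} ^ 'k::finite \<Rightarrow> 'a"
  assumes L: "A_linear_fun L" and z: "\<And>w v. w \<in> rad \<Longrightarrow> w * L v = 0" and u: "\<And>j. u $ j \<in> rad"
  shows "L u = 0"
proof -
  have "u = (\<Sum>j\<in>UNIV. ascale (u $ j) (axis j 1))"
    by (simp add: vec_eq_iff ascale_def axis_def if_distrib cong: if_cong)
  then have "L u = (\<Sum>j\<in>UNIV. L (ascale (u $ j) (axis j 1)))"
    using L linear_sum[of L] by (metis A_linear_fun_def)
  also have "\<dots> = (\<Sum>j\<in>UNIV. u $ j * L (axis j 1))" using L by (simp add: A_linear_fun_def)
  also have "\<dots> = 0" using z[OF u] by simp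
  finally show ?thesis .
qed

text \<open>As \<open>w * G\<close> is constant, \<open>w\<close> annihilates the derivative of
  \<open>G\<close> for every \<open>w\<close> in the radical, so that derivative vanishes in
  directions with components in the radical. On the connected set \<open>T\<close> local constancy
  suffices.\<close>

lemma constant_on_plaque:
  fixes \<A> :: "('m::topological_space, 'a::{euclidean_space,real_algebra_1,comm_ring_1}, 'k::finite) chart set"
  assumes A: "A_manifold_atlas \<A>" and G: "A_differentiable \<A> G" and e: "standard_basis e"
    and const: "\<And>w x y. w \<in> rad \<Longrightarrow> w * G x = w * G y"
    and "same_plaque \<A> e p q"
  shows "G p = G q"
proof -
  obtain U \<phi> T where c: "(U, \<phi>) \<in> \<A>"
    and T: "connected T" "T \<subseteq> {y \<in> U. \<forall>j. bcoord e 0 (\<phi> y $ j) = bcoord e 0 (\<phi> p $ j)}" "p \<in> T" "q \<in> T"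
    using assms(5) unfolding same_plaque_def connected_component_def by blast
  note ch = chartD[OF A c]
  define g where "g = G \<circ> inv_into U \<phi>"
  have gG: "g (\<phi> y) = G y" if "y \<in> U" for y using that by (simp add: g_def inv_into_f_f[OF ch(3)])
  have "G constant_on T"
  proof (rule locally_constant_imp_constant[OF T(1)])
    fix a assume a: "a \<in> T"
    then have "a \<in> U" using T(2) by blast
    then obtain \<epsilon> where \<epsilon>: "\<epsilon> > 0" "ball (\<phi> a) \<epsilon> \<subseteq> \<phi> ` U"
      using ch(2) open_contains_ball by blast
    \<comment> \<open>Pulling back a ball keeps the straight segment between \<open>\<phi> a\<close>
      and \<open>\<phi> y\<close> inside the chart image; \<open>G\<close> is compared along this
      segment.\<close>
    define N where "N = U \<inter> \<phi> -` ball (\<phi> a) \<epsilon>"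
    have "open N" unfolding N_def using continuous_open_preimage[OF ch(4,1)] by blast
    have "G y = G a" if y: "y \<in> T \<inter> N" for y
    proof -
      define u where "u = \<phi> y - \<phi> a"
      have yU: "y \<in> U" using y by (auto simp: N_def)
      have rad: "u $ j \<in> rad" for j
      proof -
        have "bcoord e 0 (\<phi> x $ j) = bcoord e 0 (\<phi> p $ j)" if "x \<in> T" for x
          using T(2) that by blast
        then have "bcoord e 0 (\<phi> y $ j) = bcoord e 0 (\<phi> a $ j)" using a y by simp
        then show ?thesis by (simp add: u_def bcoord_0_eq_iff[OF e])
      qed
      have line: "\<phi> a + t *\<^sub>R u \<in> \<phi> ` U" if "t \<in> {0..1}" for t
      proof -
        have "closed_segment (\<phi> a) (\<phi> y) \<subseteq> ball (\<phi> a) \<epsilon>"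
          using y \<epsilon>(1) by (intro closed_segment_subset) (auto simp: N_def)
        moreover have "\<phi> a + t *\<^sub>R u \<in> closed_segment (\<phi> a) (\<phi> y)"
          using that unfolding in_segment by (intro exI[of _ t]) (auto simp: u_def algebra_simps)
        ultimately show ?thesis using \<epsilon>(2) by blast
      qed
      have "((\<lambda>t. g (\<phi> a + t *\<^sub>R u)) has_derivative (\<lambda>h. 0)) (at t within {0..1})" if t: "t \<in> {0..1}" for t
      proof -
        obtain L where L: "(g has_derivative L) (at (\<phi> a + t *\<^sub>R u))" "A_linear_fun L"
          using A_differentiable_chartD(2)[OF G c line[OF t]] unfolding g_def by blast
        have "w * L v = 0" if "w \<in> rad" for w v
          by (rule constant_imp_derivative_zero[OF ch(2) line[OF t]
                bounded_linear.has_derivative[OF bounded_linear_mult_algebra L(1)], where c = "w * G p"])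
            (simp only: g_def o_def, rule const[OF that])
        then have "L u = 0" using A_linear_fun_zero_on_rad[OF L(2)] rad by blast
        then have L0: "L (h *\<^sub>R u) = 0" for h using L(2) by (simp add: A_linear_fun_def linear_scale)
        have "((\<lambda>t. \<phi> a + t *\<^sub>R u) has_derivative (\<lambda>h. h *\<^sub>R u)) (at t)"
          by (auto intro!: derivative_eq_intros)
        from has_derivative_compose[OF this L(1)]
        show ?thesis by (simp add: L0 has_derivative_at_withinI)
      qed
      then have "\<exists>k. \<forall>t\<in>{0..1}. g (\<phi> a + t *\<^sub>R u) = k"
        by (rule has_derivative_zero_constant[OF convex_real_interval(5)])
      then obtain k where "\<And>t. t \<in> {0..1} \<Longrightarrow> g (\<phi> a + t *\<^sub>R u) = k"
        by blast
      from this[of 0] this[of 1] have "g (\<phi> a) = g (\<phi> y)" by (simp add: u_def)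
      then show ?thesis using gG yU \<open>a \<in> U\<close> by simp
    qed
    moreover have "openin (top_of_set T) (T \<inter> N)" using \<open>open N\<close> by blast
    moreover have "a \<in> T \<inter> N" using a \<open>a \<in> U\<close> \<epsilon>(1) by (simp add: N_def)
    ultimately show "\<exists>S. openin (top_of_set T) S \<and> a \<in> S \<and> (\<forall>x\<in>S. G x = G a)" by blast
  qed
  then show ?thesis using T(3,4) unfolding constant_on_def by metis
qed

theorem theorem2:
  fixes \<A> :: "('m::{t2_space,second_countable_topology}, 'a::{euclidean_space,real_algebra_1,comm_ring_1}, 'k::finite) chart set"
    and e :: "nat \<Rightarrow> 'a"
    and G :: "'m \<Rightarrow> 'a"
  assumes "is_local TYPE('a)"
    and "DIM('a) \<ge> 2"
    and "standard_basis e"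
    and "A_manifold_atlas \<A>"
    and "compact (UNIV :: 'm set)"
    and "connected (UNIV :: 'm set)"
    and "A_differentiable \<A> G"
  shows "(\<exists>c. \<forall>x. bcoord e 0 (G x) = c) \<and>
         (\<forall>p q. same_leaf \<A> e p q \<longrightarrow> bcoord e 1 (G p) = bcoord e 1 (G q))"
proof
  have const: "w * G x = w * G y" if "w \<in> rad" for w x y
    by (rule rad_mult_constant[OF assms(1,4-7) that])
  \<comment> \<open>The dimension bound makes \<open>e 1\<close> an actual basis vector, hence a
    nonzero element of the radical.\<close>
  have "1 < DIM('a)" using assms(2) by simp
  have "e 1 \<in> span (e ` {1..<DIM('a)})" using \<open>1 < DIM('a)\<close> by (intro span_base) auto
  then have "e 1 \<in> rad" using assms(3) by (simp add: standard_basis_def)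
  have "independent (e ` {..<DIM('a)})" using assms(3) by (simp add: standard_basis_def)
  then have "0 \<notin> e ` {..<DIM('a)}" by (rule contrapos_nn[OF _ dependent_zero])
  then have "e 1 \<noteq> 0" using imageI[of 1 "{..<DIM('a)}" e] \<open>1 < DIM('a)\<close> by auto
  have "G x - G y \<in> rad" for x y
  proof (rule ccontr)
    assume "G x - G y \<notin> rad"
    then obtain z where z: "(G x - G y) * z = 1" using not_in_rad_imp_unit[OF assms(1)] by blast
    have "e 1 * (G x - G y) = 0" using const[OF \<open>e 1 \<in> rad\<close>, of x y] by (simp add: right_diff_distrib)
    then have "e 1 * ((G x - G y) * z) = 0" by (metis mult.assoc mult_zero_left)
    then show False using z \<open>e 1 \<noteq> 0\<close> by simp
  qed
  then have "bcoord e 0 (G x) = bcoord e 0 (G y)" for x y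
    by (simp add: bcoord_0_eq_iff[OF assms(3)])
  then show "\<exists>c. \<forall>x. bcoord e 0 (G x) = c" by blast
  \<comment> \<open>A leaf is reached through finite chains of plaques, and all of \<open>G\<close>
    is constant on each plaque.\<close>
  have "G p = G q" if "same_leaf \<A> e p q" for p q
    using that unfolding same_leaf_def
  proof (induction rule: rtranclp_induct)
    case (step y z)
    then show ?case using constant_on_plaque[OF assms(4,7,3) const step.hyps(2)] by simp
  qed simp
  then show "\<forall>p q. same_leaf \<A> e p q \<longrightarrow> bcoord e 1 (G p) = bcoord e 1 (G q)" by auto
qed

end
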